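(* Let $f:\mathbb{R}^n\to\mathbb{R}$ be convex, twice differentiable and bounded below, and suppose there is a constant $M>0$ such that $G(x)\preceq MI$ for all $x$ in the level set $\Omega=\{x\in\mathbb{R}^n: f(x)\le f(x_1)\}$, where $x_1=x_1^{(1)}$ is the starting point. Let $\{x_k\}_{k=1}^\infty$ denote the sequence of all iterates produced by Block BFGS, that is, the points $x_1^{(1)},\dots,x_1^{(q)},x_2^{(1)},\dots,x_2^{(q)},\dots$ enumerated in order, and let $g_k=\nabla f(x_k)$. Then $\liminf_{k\to\infty}\|g_k\|=0$.
   Context: Notation: $\|\cdot\|$ is the Euclidean norm, $\langle\cdot,\cdot\rangle$ the standard inner product, $g(x)=\nabla f(x)$, $G(x)=\nabla^2 f(x)$, and $A\preceq B$ means $B-A$ is positive semidefinite. Block BFGS. Inputs: a starting point $x_1^{(1)}=x_1\in\mathbb{R}^n$, a symmetric positive definite matrix $B_1\in\mathbb{R}^{n\times n}$, an integer $q\ge 1$, a filter threshold $\tau>0$, and line search parameters $0<\alpha<\frac12$, $\alpha<\beta<1$. For $k=1,2,3,\dots$: (i) For $i=1,\dots,q$: put $g_k^{(i)}=g(x_k^{(i)})$ and $d_k^{(i)}=-B_k^{-1}g_k^{(i)}$; choose a step size $\lambda=\lambda_k^{(i)}>0$ satisfying the Armijo-Wolfe conditions $f(x_k^{(i)}+\lambda d_k^{(i)})\le f(x_k^{(i)})+\alpha\lambda\langle g_k^{(i)},d_k^{(i)}\rangle$ and $\langle g(x_k^{(i)}+\lambda d_k^{(i)}),d_k^{(i)}\rangle\ge\beta\langle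 g_k^{(i)},d_k^{(i)}\rangle$, where $\lambda=1$ is always chosen whenever it satisfies both conditions; put $s_k^{(i)}=\lambda_k^{(i)}d_k^{(i)}$ and $x_k^{(i+1)}=x_k^{(i)}+s_k^{(i)}$. (ii) Put $G_k=G(x_k^{(q+1)})$, $S_k=[s_k^{(1)}\ \cdots\ s_k^{(q)}]$, and $D_k=\mathrm{FILTERSTEPS}(S_k,G_k)$. (iii) If $D_k$ is not empty, put $B_{k+1}=B_k-B_kD_k(D_k^TB_kD_k)^{-1}D_k^TB_k+G_kD_k(D_k^TG_kD_k)^{-1}D_k^TG_k$; if $D_k$ is empty, put $B_{k+1}=B_k$. Put $x_{k+1}^{(1)}=x_k^{(q+1)}$. FILTERSTEPS$(S,G)$ with threshold $\tau$: go through the columns of $S$ from left to right, keeping a list of retained columns, initially empty. If $D'$ is the matrix of columns retained so far and $s$ is the next column, let $\sigma^2=s^TGs-s^TGD'(D'^TGD')^{-1}D'^TGs$ (the second term is absent if $D'$ is empty); retain $s$ if $\sigma^2\ge\tau\|s\|^2$, otherwise discard it. The output $D$ is the matrix of retained columns; the values $\sigma^2$ of the retained columns are the diagonal entries of $\Sigma$ in the factorization $D^TGD=L\Sigma L^T$ with $L$ unit lower triangular and $\Sigma$ diagonal. It is assumed that no iterate has zero gradient, so that the algorithm produces infinite sequences. *)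

theory Defs
  imports
    "HOL-Analysis.Analysis"
    "Jordan_Normal_Form.Gauss_Jordan_Elimination"
begin

text \<open>Vectors and \<open>n \<times> n\<close> matrices are those of HOL-Analysis. Since the number of columns kept by the
  filter varies, a matrix with columns in \<open>\<real>\<^sup>n\<close> is the list of its columns, and Jordan_Normal_Form
  matrices are used only for the small matrices \<open>D\<^sup>T A D\<close> and their inverses.\<close>

no_notation vec_index (infixl "$" 100)
no_notation scalar_prod (infix "\<bullet>" 70)

definition gradient :: "(real^'n \<Rightarrow> real) \<Rightarrow> real^'n \<Rightarrow> real^'n" where
  "gradient f x = (THE v. GDERIV f x :> v)"

definition hessian :: "(real^'n \<Rightarrow> real) \<Rightarrow> real^'n \<Rightarrow> real^'n^'n" where
  "hessian f x = jacobian (gradient f) (at x)"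

definition twice_differentiable :: "(real^'n \<Rightarrow> real) \<Rightarrow> bool" where
  "twice_differentiable f \<longleftrightarrow>
     (\<forall>x. f differentiable (at x)) \<and> (\<forall>x. gradient f differentiable (at x))"

definition pos_semidef :: "real^'n^'n \<Rightarrow> bool" where
  "pos_semidef A \<longleftrightarrow> transpose A = A \<and> (\<forall>v. 0 \<le> v \<bullet> (A *v v))"

definition pos_def :: "real^'n^'n \<Rightarrow> bool" where
  "pos_def A \<longleftrightarrow> transpose A = A \<and> (\<forall>v. v \<noteq> 0 \<longrightarrow> 0 < v \<bullet> (A *v v))"

definition loewner_le :: "real^'n^'n \<Rightarrow> real^'n^'n \<Rightarrow> bool" where
  "loewner_le A B \<longleftrightarrow> pos_semidef (B - A)"

text \<open>\<open>D\<^sup>T A D\<close>\<close>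
definition gram :: "real^'n^'n \<Rightarrow> (real^'n) list \<Rightarrow> real Matrix.mat" where
  "gram A D = Matrix.mat (length D) (length D) (\<lambda>(i, j). (D ! i) \<bullet> (A *v (D ! j)))"

text \<open>\<open>D (D\<^sup>T A D)\<^sup>-\<^sup>1 D\<^sup>T\<close>, meaningful when \<open>D\<^sup>T A D\<close> is invertible; in the algorithm this is always so,
  because \<open>A\<close> is positive definite on the span of the retained columns, which are independent.\<close>
definition col_inv :: "real^'n^'n \<Rightarrow> (real^'n) list \<Rightarrow> real^'n^'n" where
  "col_inv A D =
     (let N = the (mat_inverse (gram A D)) in
      (\<chi> r c. \<Sum>i<length D. \<Sum>j<length D. (D ! i) $ r * N $$ (i, j) * (D ! j) $ c))"

definition filter_sigma2 :: "real^'n^'n \<Rightarrow> (real^'n) list \<Rightarrow> real^'n \<Rightarrow> real" where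
  "filter_sigma2 G D s =
     s \<bullet> (G *v s) - (if D = [] then 0 else s \<bullet> ((G ** col_inv G D ** G) *v s))"

primrec filter_from ::
  "real \<Rightarrow> real^'n^'n \<Rightarrow> (real^'n) list \<Rightarrow> (real^'n) list \<Rightarrow> (real^'n) list" where
  "filter_from \<tau> G D [] = D"
| "filter_from \<tau> G D (s # S) =
     filter_from \<tau> G (if filter_sigma2 G D s \<ge> \<tau> * (norm s)\<^sup>2 then D @ [s] else D) S"

definition filter_steps :: "real \<Rightarrow> (real^'n) list \<Rightarrow> real^'n^'n \<Rightarrow> (real^'n) list" where
  "filter_steps \<tau> S G = filter_from \<tau> G [] S"

definition block_update :: "real^'n^'n \<Rightarrow> real^'n^'n \<Rightarrow> (real^'n) list \<Rightarrow> real^'n^'n" where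
  "block_update B G D =
     (if D = [] then B else B - B ** col_inv B D ** B + G ** col_inv G D ** G)"

definition armijo_wolfe ::
  "(real^'n \<Rightarrow> real) \<Rightarrow> real \<Rightarrow> real \<Rightarrow> real^'n \<Rightarrow> real^'n \<Rightarrow> real \<Rightarrow> bool" where
  "armijo_wolfe f \<alpha> \<beta> x d l \<longleftrightarrow>
     f (x + l *\<^sub>R d) \<le> f x + \<alpha> * l * (gradient f x \<bullet> d) \<and>
     gradient f (x + l *\<^sub>R d) \<bullet> d \<ge> \<beta> * (gradient f x \<bullet> d)"

text \<open>The sequences \<open>x k i\<close>, \<open>d k i\<close>, \<open>\<lambda> k i\<close>, \<open>s k i\<close>, \<open>B k\<close> form a run of Block BFGS. Both indices
  start at 1; values at other indices are unconstrained. Nothing but the conditions below is assumed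
  of the step sizes.\<close>
definition block_bfgs_run ::
  "(real^'n \<Rightarrow> real) \<Rightarrow> real^'n \<Rightarrow> real^'n^'n \<Rightarrow> nat \<Rightarrow> real \<Rightarrow> real \<Rightarrow> real \<Rightarrow>
   (nat \<Rightarrow> nat \<Rightarrow> real^'n) \<Rightarrow> (nat \<Rightarrow> nat \<Rightarrow> real^'n) \<Rightarrow> (nat \<Rightarrow> nat \<Rightarrow> real) \<Rightarrow>
   (nat \<Rightarrow> nat \<Rightarrow> real^'n) \<Rightarrow> (nat \<Rightarrow> real^'n^'n) \<Rightarrow> bool" where
  "block_bfgs_run f x1 B1 q \<tau> \<alpha> \<beta> x d l s B \<longleftrightarrow>
     x 1 1 = x1 \<and> B 1 = B1 \<and>
     (\<forall>k\<ge>1.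
        (\<forall>i\<in>{1..q}.
           d k i = - (matrix_inv (B k) *v gradient f (x k i)) \<and>
           l k i > 0 \<and>
           armijo_wolfe f \<alpha> \<beta> (x k i) (d k i) (l k i) \<and>
           (armijo_wolfe f \<alpha> \<beta> (x k i) (d k i) 1 \<longrightarrow> l k i = 1) \<and>
           s k i = l k i *\<^sub>R d k i \<and>
           x k (i + 1) = x k i + s k i) \<and>
        (let G = hessian f (x k (q + 1)); S = map (s k) [1..<q + 1] in
           B (k + 1) = block_update (B k) G (filter_steps \<tau> S G)) \<and>
        x (k + 1) 1 = x k (q + 1))"

text \<open>The enumeration \<open>x 1 1, \<dots>, x 1 q, x 2 1, \<dots>, x 2 q, \<dots>\<close>, indexed from 0.\<close>
definition all_iterates :: "nat \<Rightarrow> (nat \<Rightarrow> nat \<Rightarrow> real^'n) \<Rightarrow> nat \<Rightarrow> real^'n" where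
  "all_iterates q x m = x (m div q + 1) (m mod q + 1)"

end

theory Submission
  imports Defs "Jordan_Normal_Form.Determinant"
begin

hide_const (open) Determinant.det
no_notation vec_index (infixl "$" 100)
no_notation scalar_prod (infix "\<bullet>" 70)

text \<open>
The argument weighs the angle between step and gradient against the trace and the determinant of
the matrices, as in Powell's convergence proof for BFGS. Suppose that the gradients stay away from
zero. The Armijo condition, the Wolfe condition and the bound on the Hessian make \<open>f\<close> decrease in a
step \<open>s\<close> by at least a constant times \<open>(g \<bullet> s)\<^sup>2 / \<parallel>s\<parallel>\<^sup>2\<close> (lemma \<open>armijo_wolfe_decrease\<close>), and \<open>f\<close> is
bounded below; hence the cosine of the angle between \<open>g\<close> and \<open>s\<close> tends to zero. Since \<open>B s\<close> is a
negative multiple of \<open>g\<close>, this says that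
\<open>(s \<bullet> B s)\<^sup>2 / (\<parallel>B s\<parallel>\<^sup>2 \<parallel>s\<parallel>\<^sup>2)\<close> tends to zero along the run. Lemma \<open>block_updates_angle_condition\<close>
shows that block updates with filtered steps do not allow this.

For that lemma, consider \<open>tr B - ln |det B|\<close>, which is bounded below on the positive definite
matrices. A block update with retained steps \<open>D\<close> adds at most \<open>tr G\<close> to the trace and removes at least
the largest of the numbers \<open>a\<^sub>s = \<parallel>B s\<parallel>\<^sup>2 / (s \<bullet> B s)\<close> for \<open>s\<close> in \<open>D\<close>, while the filter guarantees that the determinant is
multiplied at least by the product of the numbers \<open>\<tau> c\<^sub>s\<close> with \<open>c\<^sub>s = \<parallel>s\<parallel>\<^sup>2 / (s \<bullet> B s)\<close>. The product
\<open>a\<^sub>s c\<^sub>s\<close> is the squared reciprocal of the cosine, so as soon as the cosines are small the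
decrease of the trace outweighs the possible decrease of \<open>ln |det B|\<close> and every
update with nonempty \<open>D\<close> lowers the quantity by at least 1. Therefore \<open>D\<close> is eventually always empty
and \<open>B\<close> is eventually constant; but for one fixed positive definite matrix the cosines are bounded
away from zero.

The two estimates of a block update rest on a description of \<open>D (D\<^sup>T A D)\<^sup>-\<^sup>1 D\<^sup>T\<close> free of coordinates:
it is the only symmetric matrix with values in the span of \<open>D\<close> that inverts \<open>A\<close> there. The
description shows how this matrix changes when a column is appended, and so that a block update is a
succession of ordinary BFGS updates along \<open>G\<close>-conjugate directions, with curvatures the numbers
\<open>\<sigma>\<^sup>2\<close> of the filter (lemma \<open>block_update_append\<close>).
\<close>

section \<open>Symmetric and positive definite matrices\<close>

definition outer :: "real^'n \<Rightarrow> real^'n \<Rightarrow> real^'n^'n" where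
  "outer v w = (\<chi> i j. v $ i * w $ j)"

lemma outer_mult_vector [simp]: "outer v w *v u = (w \<bullet> u) *\<^sub>R v"
  by (simp add: Finite_Cartesian_Product.vec_eq_iff outer_def matrix_vector_mult_def inner_vec_def sum_distrib_right
      sum_distrib_left mult_ac)

lemma outer_vector_mult [simp]: "u v* outer v w = (u \<bullet> v) *\<^sub>R w"
  by (simp add: Finite_Cartesian_Product.vec_eq_iff outer_def vector_matrix_mult_def inner_vec_def sum_distrib_right
      sum_distrib_left mult_ac)

lemma trace_outer: "trace (outer v w) = v \<bullet> w"
  by (simp add: trace_def outer_def inner_vec_def)

lemma trace_scaleR: "trace (c *\<^sub>R A) = c * trace (A :: real^'n^'n)"
  by (simp add: trace_def sum_distrib_left)

lemmas mat_vec_simps = matrix_vector_mult_add_rdistrib matrix_vector_mult_diff_rdistrib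
  scaleR_matrix_vector_assoc [symmetric] matrix_vector_mul_assoc [symmetric]
  matrix_vector_right_distrib matrix_vector_mult_diff_distrib matrix_vector_mult_scaleR
  inner_add_left inner_add_right inner_diff_left inner_diff_right

lemma symmetric_iff_inner:
  fixes A :: "real^'n^'n"
  shows "transpose A = A \<longleftrightarrow> (\<forall>u v. u \<bullet> (A *v v) = (A *v u) \<bullet> v)"
proof
  assume "transpose A = A"
  then show "\<forall>u v. u \<bullet> (A *v v) = (A *v u) \<bullet> v"
    by (metis dot_lmul_matrix transpose_matrix_vector)
next
  assume *: "\<forall>u v. u \<bullet> (A *v v) = (A *v u) \<bullet> v"
  have "(transpose A *v u) \<bullet> v = (A *v u) \<bullet> v" for u v
    using * by (metis dot_lmul_matrix transpose_matrix_vector)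
  then show "transpose A = A"
    by (metis matrix_eq vector_eq_rdot)
qed

lemma symmetric_inner:
  "transpose A = A \<Longrightarrow> u \<bullet> (A *v v) = (A *v u) \<bullet> v" for A :: "real^'n^'n"
  by (simp add: symmetric_iff_inner)

lemma diag_eq_inner: "A $ i $ i = axis i 1 \<bullet> (A *v axis i 1)" for A :: "real^'n^'n"
  by (simp add: inner_axis' matrix_vector_mult_basis column_def)

lemma trace_mono:
  fixes A B :: "real^'n^'n"
  assumes "\<And>v. v \<bullet> (A *v v) \<le> v \<bullet> (B *v v)"
  shows "trace A \<le> trace B"
  using assms by (simp add: trace_def diag_eq_inner sum_mono)

lemma pos_def_invertible: "pos_def A \<Longrightarrow> invertible A" for A :: "real^'n^'n"
proof -
  assume A: "pos_def A"
  have "x = 0" if "A *v x = 0" for x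
    using A that by (metis inner_zero_right less_irrefl pos_def_def)
  then show ?thesis
    by (metis invertible_left_inverse matrix_left_invertible_ker)
qed

lemma pos_def_det_nonzero: "pos_def A \<Longrightarrow> det A \<noteq> 0" for A :: "real^'n^'n"
  using pos_def_invertible invertible_det_nz by blast

lemma pos_def_congruence:
  fixes B E :: "real^'n^'n"
  assumes B: "pos_def B" and E: "invertible E"
  shows "pos_def (E ** B ** transpose E)"
proof -
  have sym: "transpose B = B" using B by (simp add: pos_def_def)
  have "0 < v \<bullet> ((E ** B ** transpose E) *v v)" if "v \<noteq> 0" for v
  proof -
    have "transpose E *v v \<noteq> 0"
      using E that by (metis inj_matrix_vector_mult injD matrix_vector_mult_0_right transpose_invertible)
    moreover have "v \<bullet> ((E ** B ** transpose E) *v v) = (transpose E *v v) \<bullet> (B *v (transpose E *v v))"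
      by (simp add: matrix_vector_mul_assoc [symmetric] dot_lmul_matrix transpose_matrix_vector)
    ultimately show ?thesis using B by (simp add: pos_def_def)
  qed
  then show ?thesis
    by (simp add: pos_def_def matrix_transpose_mul sym matrix_mul_assoc)
qed

text \<open>An orthogonal change of basis turns \<open>w\<close> into a multiple of a basis vector; then only one column of
  the matrix differs from the identity, and Cramer's rule gives its determinant.\<close>
lemma det_add_outer:
  fixes v w :: "real^'n"
  shows "det (Finite_Cartesian_Product.mat 1 + outer v w) = 1 + w \<bullet> v"
proof -
  let ?I = "Finite_Cartesian_Product.mat 1 :: real^'n^'n"
  obtain k :: 'n where True by simp
  let ?e = "axis k 1 :: real^'n"
  obtain f where f: "orthogonal_transformation f" "f (norm w *\<^sub>R ?e) = w"
    by (rule orthogonal_transformation_exists [of "norm w *\<^sub>R ?e" w]) simp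
  define Q where "Q = matrix f"
  have Qf: "Q *v u = f u" for u
    using f(1) by (simp add: Q_def orthogonal_transformation_linear matrix_works)
  have Q: "orthogonal_matrix Q"
    using f(1) unfolding Q_def orthogonal_transformation_matrix by simp
  then have QQ: "transpose Q ** Q = ?I" "Q ** transpose Q = ?I"
    by (auto simp: orthogonal_matrix_def)
  define v' where "v' = transpose Q *v v"
  have Qv': "Q *v v' = v"
    by (simp add: v'_def matrix_vector_mul_assoc QQ del: transpose_matrix_vector)
  have Qw: "norm w *\<^sub>R (Q *v ?e) = w"
    using f(2) by (simp add: Qf [symmetric] matrix_vector_mult_scaleR)
  have wu: "w \<bullet> (Q *v u) = norm w * (u $ k)" for u
  proof -
    have "w \<bullet> (Q *v u) = norm w * ((Q *v ?e) \<bullet> (Q *v u))"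
      by (metis Qw inner_scaleR_left)
    also have "(Q *v ?e) \<bullet> (Q *v u) = ?e \<bullet> u"
      using f(1) by (simp add: Qf orthogonal_transformation_def)
    finally show ?thesis by (simp add: inner_axis')
  qed
  let ?C = "?I + outer v' (norm w *\<^sub>R ?e)"
  have "(?I + outer v w) ** Q = Q ** ?C"
    unfolding matrix_eq
    by (simp add: mat_vec_simps wu Qv' inner_axis')
  then have "det ((?I + outer v w) ** Q) = det (Q ** ?C)" by simp
  moreover have "det Q \<noteq> 0"
    using det_orthogonal_matrix [OF Q] by auto
  ultimately have eq: "det (?I + outer v w) = det ?C"
    by (simp add: det_mul)
  define z where "z = ?e + norm w *\<^sub>R v'"
  have "?C = (\<chi> i j. if j = k then (?I *v z) $ i else ?I $ i $ j)"
    unfolding matrix_vector_mul_lid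
    by (auto simp: Finite_Cartesian_Product.vec_eq_iff outer_def z_def axis_def Finite_Cartesian_Product.mat_def)
  then have "det ?C = z $ k"
    by (simp only: cramer_lemma) simp
  also have "z $ k = 1 + w \<bullet> v"
    using wu [of v'] by (simp add: z_def Qv')
  finally show ?thesis using eq by simp
qed

text \<open>The BFGS update is a congruence \<open>E B E\<^sup>T\<close> in which \<open>E\<close> is a rank-one perturbation of the identity.
  Positive definiteness and the determinant both follow from this factorization.\<close>
lemma bfgs_update:
  fixes B :: "real^'n^'n"
  assumes B: "pos_def B" and yr: "0 < y \<bullet> r"
  defines "B' \<equiv> B - (1 / (r \<bullet> (B *v r))) *\<^sub>R outer (B *v r) (B *v r) + (1 / (y \<bullet> r)) *\<^sub>R outer y y"
  shows "pos_def B'" and "det B' = det B * ((y \<bullet> r) / (r \<bullet> (B *v r)))"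
proof -
  let ?I = "Finite_Cartesian_Product.mat 1 :: real^'n^'n"
  define b where "b = r \<bullet> (B *v r)"
  define \<sigma> where "\<sigma> = y \<bullet> r"
  have sym: "transpose B = B" using B by (simp add: pos_def_def)
  have b: "b > 0" using B yr unfolding b_def by (metis inner_zero_right less_irrefl pos_def_def)
  have \<sigma>: "\<sigma> > 0" using yr by (simp add: \<sigma>_def)
  \<comment> \<open>With this scaling \<open>y y\<^sup>T\<close> gets the coefficient \<open>1 / \<sigma>\<close> in \<open>E B E\<^sup>T\<close>.\<close>
  define c where "c = sqrt (b / \<sigma>)"
  have c2: "c * c = b / \<sigma>" using b \<sigma> by (simp add: c_def)
  define E where "E = ?I + outer ((1/b) *\<^sub>R (c *\<^sub>R y - B *v r)) r"
  have tE: "transpose E *v u = u + (((1/b) *\<^sub>R (c *\<^sub>R y - B *v r)) \<bullet> u) *\<^sub>R r" for u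
    by (simp add: E_def transpose_matrix_vector vector_matrix_left_distrib vector_matrix_mult_add_rdistrib inner_commute)
  have detE: "det E = c * \<sigma> / b"
    using b by (simp add: E_def det_add_outer inner_diff_right \<sigma>_def [symmetric] b_def [symmetric]
        inner_commute [of r y] field_simps)
  have B'E: "E ** B ** transpose E = B'"
    unfolding matrix_eq
  proof
    fix x
    have Br: "r \<bullet> (B *v x) = (B *v r) \<bullet> x" by (rule symmetric_inner [OF sym])
    define p where "p = (c * (y \<bullet> x) - (B *v r) \<bullet> x) / b"
    have tEx: "transpose E *v x = x + p *\<^sub>R r"
      unfolding tE by (simp add: p_def inner_diff_left)
    have Eu: "E *v u = u + ((r \<bullet> u) / b) *\<^sub>R (c *\<^sub>R y - B *v r)" for u
      by (simp add: E_def mat_vec_simps)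
    have "r \<bullet> (B *v (x + p *\<^sub>R r)) = c * (y \<bullet> x)"
      using b by (simp add: mat_vec_simps b_def [symmetric] Br p_def)
    then have "(E ** B ** transpose E) *v x =
        (B *v x + p *\<^sub>R (B *v r)) + (c * (y \<bullet> x) / b) *\<^sub>R (c *\<^sub>R y - B *v r)"
      unfolding matrix_vector_mul_assoc [symmetric] tEx Eu
      by (simp add: mat_vec_simps)
    also have "\<dots> = B *v x + (p - c * (y \<bullet> x) / b) *\<^sub>R (B *v r) + ((c * c) * (y \<bullet> x) / b) *\<^sub>R y"
      by (simp add: algebra_simps)
    also have "p - c * (y \<bullet> x) / b = - (((B *v r) \<bullet> x) / b)"
      by (simp add: p_def diff_divide_distrib)
    also have "(c * c) * (y \<bullet> x) / b = (y \<bullet> x) / \<sigma>"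
      using b by (simp add: c2)
    finally show "(E ** B ** transpose E) *v x = B' *v x"
      by (simp add: B'_def mat_vec_simps b_def [symmetric] \<sigma>_def [symmetric])
  qed
  have "det E \<noteq> 0" using detE b \<sigma> by (simp add: c_def)
  then have "invertible E" by (simp add: invertible_det_nz)
  then show "pos_def B'" using pos_def_congruence [OF B] B'E by metis
  have "det B' = det B * (det E * det E)"
    by (simp add: B'E [symmetric] det_mul det_transpose)
  also have "det E * det E = (c * c) * \<sigma> * \<sigma> / (b * b)"
    by (simp add: detE)
  also have "\<dots> = \<sigma> / b" using b \<sigma> unfolding c2 by (simp add: field_simps)
  finally show "det B' = det B * ((y \<bullet> r) / (r \<bullet> (B *v r)))"
    by (simp add: \<sigma>_def b_def)
qed

section \<open>Inverting a matrix on the span of a list of columns\<close>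

text \<open>For \<open>V\<close> the span of the columns of \<open>D\<close>, the matrix \<open>Z\<close> is \<open>D (D\<^sup>T A D)\<^sup>-\<^sup>1 D\<^sup>T\<close>, and \<open>Z A\<close> is the
  \<open>A\<close>-orthogonal projection onto \<open>V\<close>.\<close>
definition inverse_on :: "real^'n^'n \<Rightarrow> (real^'n) set \<Rightarrow> real^'n^'n \<Rightarrow> bool" where
  "inverse_on A V Z \<longleftrightarrow> transpose Z = Z \<and> (\<forall>u\<in>V. Z *v (A *v u) = u) \<and> (\<forall>v. Z *v v \<in> V)"

definition pos_def_on :: "(real^'n) set \<Rightarrow> real^'n^'n \<Rightarrow> bool" where
  "pos_def_on V A \<longleftrightarrow> (\<forall>v\<in>V. v \<noteq> 0 \<longrightarrow> 0 < v \<bullet> (A *v v))"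

text \<open>Both \<open>Z A Z' = Z'\<close> and \<open>Z' A Z = Z\<close> hold, since each matrix has its values in \<open>V\<close>; transposing one of
  the two products gives the other.\<close>
lemma inverse_on_unique:
  fixes A :: "real^'n^'n"
  assumes A: "transpose A = A" and Z: "inverse_on A V Z" "inverse_on A V Z'"
  shows "Z = Z'"
proof -
  have 1: "Z' ** A ** Z = Z" and 2: "Z ** A ** Z' = Z'"
    using Z by (auto simp: matrix_eq inverse_on_def matrix_vector_mul_assoc [symmetric])
  have "transpose (Z ** A ** Z') = Z' ** A ** Z"
    using Z A by (simp add: matrix_transpose_mul matrix_mul_assoc inverse_on_def)
  then show ?thesis
    using 1 2 Z by (simp add: inverse_on_def)
qed

text \<open>The vector \<open>r\<close> is what a Gram-Schmidt step for the form \<open>A\<close> leaves of \<open>s\<close>.\<close>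
lemma inverse_on_residual:
  fixes A :: "real^'n^'n" and s :: "real^'n"
  assumes A: "transpose A = A" and Z: "inverse_on A V Z"
  defines "r \<equiv> s - Z *v (A *v s)"
  shows "u \<in> V \<Longrightarrow> u \<bullet> (A *v r) = 0"
    and "r \<bullet> (A *v r) = s \<bullet> (A *v s) - (A *v s) \<bullet> (Z *v (A *v s))"
    and "Z *v (A *v r) = 0"
proof -
  have Zs: "transpose Z = Z" and ZA: "\<And>u. u \<in> V \<Longrightarrow> Z *v (A *v u) = u" and ZV: "\<And>v. Z *v v \<in> V"
    using Z by (auto simp: inverse_on_def)
  have orth: "u \<bullet> (A *v r) = 0" if "u \<in> V" for u
  proof -
    have "u \<bullet> (A *v (Z *v (A *v s))) = (Z *v (A *v u)) \<bullet> (A *v s)"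
      by (simp add: symmetric_inner [OF A] symmetric_inner [OF Zs])
    also have "\<dots> = u \<bullet> (A *v s)" using ZA [OF that] by simp
    finally show ?thesis by (simp add: r_def mat_vec_simps)
  qed
  show "u \<in> V \<Longrightarrow> u \<bullet> (A *v r) = 0" by (rule orth)
  have "r \<bullet> (A *v r) = s \<bullet> (A *v r)"
    using orth [OF ZV [of "A *v s"]] by (simp add: r_def inner_diff_left)
  also have "\<dots> = s \<bullet> (A *v s) - (A *v s) \<bullet> (Z *v (A *v s))"
    by (simp add: r_def mat_vec_simps symmetric_inner [OF A, of s])
  finally show "r \<bullet> (A *v r) = s \<bullet> (A *v s) - (A *v s) \<bullet> (Z *v (A *v s))" .
  show "Z *v (A *v r) = 0"
    using ZA [OF ZV [of "A *v s"]] by (simp add: r_def mat_vec_simps)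
qed

text \<open>Appending a column changes the inverse on the span by a rank-one term along the Gram-Schmidt
  residual: on the old span nothing changes because \<open>r\<close> is \<open>A\<close>-orthogonal to it, and the old inverse
  annihilates \<open>A r\<close>.\<close>
lemma inverse_on_insert:
  fixes A :: "real^'n^'n" and s :: "real^'n"
  assumes A: "transpose A = A" and Z: "inverse_on A (span S) Z"
  defines "r \<equiv> s - Z *v (A *v s)"
  assumes r: "r \<bullet> (A *v r) \<noteq> 0"
  shows "inverse_on A (span (insert s S)) (Z + (1 / (r \<bullet> (A *v r))) *\<^sub>R outer r r)"
    (is "inverse_on A _ ?Z")
proof -
  have Zs: "transpose Z = Z" and ZA: "\<And>u. u \<in> span S \<Longrightarrow> Z *v (A *v u) = u"
    and ZV: "\<And>v. Z *v v \<in> span S"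
    using Z by (auto simp: inverse_on_def)
  note res = inverse_on_residual [OF A Z, where s = s, folded r_def]
  have mono: "span S \<subseteq> span (insert s S)" by (rule span_mono) auto
  have rs: "r \<in> span (insert s S)"
    unfolding r_def using ZV mono by (intro span_diff) (auto intro: span_base)
  have "?Z *v v \<in> span (insert s S)" for v
    using ZV [of v] mono rs by (simp add: mat_vec_simps) (intro span_add span_scale, auto)
  moreover have "?Z *v (A *v u) = u" if u: "u \<in> span (insert s S)" for u
  proof -
    obtain k where k: "u - k *\<^sub>R s \<in> span S" using u by (auto simp: span_breakdown_eq)
    define w where "w = u - k *\<^sub>R r"
    have "w = (u - k *\<^sub>R s) + k *\<^sub>R (Z *v (A *v s))" by (simp add: w_def r_def algebra_simps)
    then have w: "w \<in> span S" using k ZV by (simp add: span_add span_scale)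
    have uw: "u = w + k *\<^sub>R r" by (simp add: w_def)
    have rw: "r \<bullet> (A *v w) = 0"
      using res(1) [OF w] symmetric_inner [OF A, of r w] by (simp add: inner_commute)
    show ?thesis
      unfolding uw using r ZA [OF w] res(3) rw by (simp add: mat_vec_simps)
  qed
  moreover have "transpose ?Z = ?Z"
    unfolding symmetric_iff_inner
    by (simp add: mat_vec_simps symmetric_inner [OF Zs]) (simp add: inner_commute)
  ultimately show ?thesis by (simp add: inverse_on_def)
qed

text \<open>An orthogonal projection for a semidefinite form does not increase the energy of a vector.\<close>
lemma inverse_on_energy:
  fixes A :: "real^'n^'n"
  assumes A: "pos_semidef A" and Z: "inverse_on A V Z"
  shows "0 \<le> (A *v v) \<bullet> (Z *v (A *v v))" and "(A *v v) \<bullet> (Z *v (A *v v)) \<le> v \<bullet> (A *v v)"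
proof -
  have sym: "transpose A = A" and psd: "\<And>v. 0 \<le> v \<bullet> (A *v v)" using A by (auto simp: pos_semidef_def)
  note res = inverse_on_residual [OF sym Z, where s = v]
  show "(A *v v) \<bullet> (Z *v (A *v v)) \<le> v \<bullet> (A *v v)"
    using psd [of "v - Z *v (A *v v)"] res(2) by simp
  have "(Z *v (A *v v)) \<bullet> (A *v (Z *v (A *v v))) = (Z *v (A *v v)) \<bullet> (A *v v)"
    using res(1) [of "Z *v (A *v v)"] Z by (simp add: mat_vec_simps inverse_on_def)
  then show "0 \<le> (A *v v) \<bullet> (Z *v (A *v v))"
    using psd [of "Z *v (A *v v)"] by (simp add: inner_commute)
qed

lemma col_inv_mult_vector:
  "col_inv A D *v v =
     (\<Sum>i<length D. (\<Sum>j<length D. the (mat_inverse (gram A D)) $$ (i, j) * ((D ! j) \<bullet> v)) *\<^sub>R (D ! i))"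
proof -
  let ?n = "length D" and ?N = "the (mat_inverse (gram A D))"
  have "(col_inv A D *v v) $ r =
    (\<Sum>i<?n. (\<Sum>j<?n. ?N $$ (i, j) * ((D ! j) \<bullet> v)) * (D ! i) $ r)" for r
  proof -
    have "(col_inv A D *v v) $ r =
      (\<Sum>c\<in>UNIV. \<Sum>i<?n. \<Sum>j<?n. (D ! i) $ r * ?N $$ (i, j) * (D ! j) $ c * v $ c)"
      by (simp add: col_inv_def matrix_vector_mult_def Let_def sum_distrib_right)
    also have "\<dots> = (\<Sum>i<?n. \<Sum>j<?n. \<Sum>c\<in>UNIV. (D ! i) $ r * ?N $$ (i, j) * (D ! j) $ c * v $ c)"
      by (subst sum.swap, rule sum.cong [OF refl], rule sum.swap)
    also have "\<dots> = (\<Sum>i<?n. (\<Sum>j<?n. ?N $$ (i, j) * ((D ! j) \<bullet> v)) * (D ! i) $ r)"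
      by (simp add: inner_vec_def sum_distrib_left sum_distrib_right mult_ac)
    finally show ?thesis .
  qed
  then show ?thesis by (simp add: Finite_Cartesian_Product.vec_eq_iff)
qed

lemma independent_list_sum_zero:
  fixes D :: "(real^'n) list"
  assumes "distinct D" "independent (set D)" "(\<Sum>j<length D. c j *\<^sub>R (D ! j)) = 0" "i < length D"
  shows "c i = 0"
proof -
  define g where "g v = c (the_inv_into {..<length D} ((!) D) v)" for v
  have bij: "bij_betw ((!) D) {..<length D} (set D)" by (rule bij_betw_nth) (use assms in auto)
  have g: "g (D ! j) = c j" if "j < length D" for j
    using bij that by (simp add: g_def bij_betw_def the_inv_into_f_f)
  have "(\<Sum>v\<in>set D. g v *\<^sub>R v) = (\<Sum>j<length D. g (D ! j) *\<^sub>R (D ! j))"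
    by (rule sum.reindex_bij_betw [OF bij, symmetric])
  also have "\<dots> = 0" using assms(3) g by simp
  finally have "g (D ! i) = 0"
    using assms by (intro independentD [OF assms(2), of "set D"]) auto
  then show ?thesis using g assms(4) by simp
qed

text \<open>A vector in the kernel of the Gram matrix gives a combination \<open>u\<close> of the columns with \<open>u \<bullet> A u = 0\<close>;
  definiteness and independence make it trivial, so the Gram matrix is invertible.\<close>
lemma gram_inverse:
  fixes A :: "real^'n^'n"
  assumes D: "distinct D" "independent (set D)" and A: "pos_def_on (span (set D)) A"
  obtains N where "mat_inverse (gram A D) = Some N" "N \<in> carrier_mat (length D) (length D)"
    "gram A D * N = 1\<^sub>m (length D)" "N * gram A D = 1\<^sub>m (length D)"
proof -
  let ?n = "length D" and ?G = "gram A D"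
  have G: "?G \<in> carrier_mat ?n ?n" by (simp add: gram_def)
  have "Determinant.det ?G \<noteq> 0"
  proof
    assume "Determinant.det ?G = 0"
    then obtain v where v: "v \<in> carrier_vec ?n" "v \<noteq> 0\<^sub>v ?n" "?G *\<^sub>v v = 0\<^sub>v ?n"
      using det_0_iff_vec_prod_zero [OF G] by auto
    define u where "u = (\<Sum>j<?n. (vec_index v j) *\<^sub>R (D ! j))"
    have uV: "u \<in> span (set D)"
      unfolding u_def by (intro span_sum span_scale span_base) auto
    have "(D ! i) \<bullet> (A *v u) = 0" if i: "i < ?n" for i
    proof -
      have "(D ! i) \<bullet> (A *v u) = (\<Sum>j<?n. vec_index v j * ((D ! i) \<bullet> (A *v (D ! j))))"
        by (simp add: u_def linear_sum [OF matrix_vector_mul_linear] inner_sum_right matrix_vector_mult_scaleR)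
      also have "\<dots> = vec_index (?G *\<^sub>v v) i"
        using v(1) i by (simp add: gram_def scalar_prod_def atLeast0LessThan mult.commute)
      also have "\<dots> = 0" using v i by simp
      finally show ?thesis .
    qed
    then have "u \<bullet> (A *v u) = 0"
      by (subst u_def, simp add: inner_sum_left)
    then have "u = 0" using A uV by (auto simp: pos_def_on_def)
    then have "vec_index v i = 0" if "i < ?n" for i
      using independent_list_sum_zero [OF D, of "vec_index v" i] that by (simp add: u_def)
    then have "v = 0\<^sub>v ?n" using v(1) by (intro eq_vecI) auto
    then show False using v by simp
  qed
  then have U: "?G \<in> Units (ring_mat TYPE(real) ?n ())" by (rule det_non_zero_imp_unit [OF G])
  show ?thesis
  proof (cases "mat_inverse ?G")
    case None
    then show ?thesis using mat_inverse(1) [OF G None, of "()"] U by simp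
  next
    case (Some N)
    then show ?thesis using that mat_inverse(2) [OF G Some] by blast
  qed
qed

text \<open>On a column of \<open>D\<close> the claim \<open>Z A u = u\<close> is one column of the matrix identity
  \<open>(D\<^sup>T A D)\<^sup>-\<^sup>1 (D\<^sup>T A D) = I\<close>, and the symmetry of \<open>Z\<close> comes from that of the inverse Gram matrix.\<close>
lemma inverse_on_col_inv:
  fixes A :: "real^'n^'n"
  assumes sym: "transpose A = A" and D: "distinct D" "independent (set D)"
    and A: "pos_def_on (span (set D)) A"
  shows "inverse_on A (span (set D)) (col_inv A D)"
proof -
  let ?n = "length D" and ?G = "gram A D"
  obtain N where N: "mat_inverse ?G = Some N" "N \<in> carrier_mat ?n ?n" "?G * N = 1\<^sub>m ?n" "N * ?G = 1\<^sub>m ?n"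
    using gram_inverse [OF D A] by metis
  have G: "?G \<in> carrier_mat ?n ?n" by (simp add: gram_def)
  have Gs: "transpose_mat ?G = ?G"
    by (rule eq_matI) (simp_all add: gram_def, metis symmetric_inner [OF sym] inner_commute)
  have "transpose_mat N = transpose_mat N * (?G * N)" using N by simp
  also have "\<dots> = (transpose_mat N * transpose_mat ?G) * N"
    using N G Gs by (simp add: assoc_mult_mat [of _ ?n ?n _ ?n _ ?n])
  also have "\<dots> = N"
    using N G by (simp add: transpose_mult [of _ ?n ?n _ ?n, symmetric])
  finally have Ns: "transpose_mat N = N" .
  have Nij: "N $$ (i, j) = N $$ (j, i)" if "i < ?n" "j < ?n" for i j
    using N(2) that by (subst (1) Ns [symmetric]) auto
  let ?Z = "col_inv A D"
  have Z: "?Z *v v = (\<Sum>i<?n. (\<Sum>j<?n. N $$ (i, j) * ((D ! j) \<bullet> v)) *\<^sub>R (D ! i))" for v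
    by (simp add: col_inv_mult_vector N(1))
  have "?Z *v v \<in> span (set D)" for v
    unfolding Z by (intro span_sum span_scale span_base) auto
  moreover have "?Z *v (A *v u) = u" if "u \<in> span (set D)" for u
    using that
  proof (induction rule: span_induct_alt)
    case base
    show ?case by simp
  next
    case (step c x y)
    obtain k where k: "k < ?n" "x = D ! k" using step(1) by (auto simp: in_set_conv_nth)
    have "(\<Sum>j<?n. N $$ (i, j) * ((D ! j) \<bullet> (A *v x))) = (if i = k then 1 else 0)" if "i < ?n" for i
    proof -
      have "(\<Sum>j<?n. N $$ (i, j) * ((D ! j) \<bullet> (A *v x))) = (N * ?G) $$ (i, k)"
        using N(2) that k by (simp add: gram_def scalar_prod_def atLeast0LessThan)
      then show ?thesis using that k by (simp add: N(4))
    qed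
    then have "?Z *v (A *v x) = (\<Sum>i<?n. (if i = k then 1 else 0) *\<^sub>R (D ! i))"
      unfolding Z by (intro sum.cong) auto
    also have "\<dots> = x" using k by (simp add: if_distrib [of "\<lambda>c. c *\<^sub>R _"] sum.delta cong: if_cong)
    finally show ?case using step by (simp add: mat_vec_simps)
  qed
  moreover have "transpose ?Z = ?Z"
    unfolding symmetric_iff_inner
  proof (intro allI)
    fix u v
    have "u \<bullet> (?Z *v v) = (\<Sum>i<?n. \<Sum>j<?n. N $$ (i, j) * ((D ! j) \<bullet> v) * ((D ! i) \<bullet> u))"
      by (simp add: Z inner_sum_right sum_distrib_right inner_commute)
    also have "\<dots> = (\<Sum>j<?n. \<Sum>i<?n. N $$ (i, j) * ((D ! j) \<bullet> v) * ((D ! i) \<bullet> u))"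
      by (rule sum.swap)
    also have "\<dots> = (\<Sum>j<?n. \<Sum>i<?n. N $$ (j, i) * ((D ! i) \<bullet> u) * ((D ! j) \<bullet> v))"
      by (intro sum.cong refl) (simp add: Nij mult_ac)
    also have "\<dots> = (?Z *v u) \<bullet> v"
      by (simp add: Z inner_sum_left sum_distrib_right)
    finally show "u \<bullet> (?Z *v v) = (?Z *v u) \<bullet> v" .
  qed
  ultimately show ?thesis by (simp add: inverse_on_def)
qed

lemma col_inv_append:
  fixes A :: "real^'n^'n"
  assumes sym: "transpose A = A" and D: "distinct (D @ [s])" "independent (set (D @ [s]))"
    and A: "pos_def_on (span (set (D @ [s]))) A"
  defines "r \<equiv> s - col_inv A D *v (A *v s)"
  shows "col_inv A (D @ [s]) = col_inv A D + (1 / (r \<bullet> (A *v r))) *\<^sub>R outer r r"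
    and "0 < r \<bullet> (A *v r)"
proof -
  have sub: "span (set D) \<subseteq> span (set (D @ [s]))" by (rule span_mono) auto
  have D': "distinct D" "independent (set D)" "pos_def_on (span (set D)) A"
    using D A sub by (auto simp: pos_def_on_def independent_insert dest: independent_mono)
  note Z = inverse_on_col_inv [OF sym D']
  have ZV: "col_inv A D *v v \<in> span (set D)" for v using Z by (simp add: inverse_on_def)
  have "s \<notin> span (set D)"
    using D by (auto simp: independent_insert split: if_splits)
  then have "r \<noteq> 0" using ZV [of "A *v s"] by (metis eq_iff_diff_eq_0 r_def)
  moreover have "r \<in> span (set (D @ [s]))"
    unfolding r_def using ZV sub by (intro span_diff) (auto intro: span_base)
  ultimately show pos: "0 < r \<bullet> (A *v r)"
    using A by (auto simp: pos_def_on_def)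
  have ins: "insert s (set D) = set (D @ [s])" by simp
  have "inverse_on A (span (set (D @ [s]))) (col_inv A D + (1 / (r \<bullet> (A *v r))) *\<^sub>R outer r r)"
    using inverse_on_insert [OF sym Z, of s, folded r_def] pos unfolding ins by simp
  then show "col_inv A (D @ [s]) = col_inv A D + (1 / (r \<bullet> (A *v r))) *\<^sub>R outer r r"
    using inverse_on_unique [OF sym] inverse_on_col_inv [OF sym D A] by blast
qed

section \<open>The filter and the block update\<close>

text \<open>The lists that the filter can build up, generated from the right as the algorithm does. Steps of
  length zero would pass the test but destroy independence, hence the condition \<open>s \<noteq> 0\<close>.\<close>
inductive filtered :: "real \<Rightarrow> real^'n^'n \<Rightarrow> (real^'n) list \<Rightarrow> bool" for \<tau> G where
  Nil: "filtered \<tau> G []"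
| snoc: "filtered \<tau> G D \<Longrightarrow> s \<noteq> 0 \<Longrightarrow> \<tau> * (norm s)\<^sup>2 \<le> filter_sigma2 G D s \<Longrightarrow> filtered \<tau> G (D @ [s])"

lemma filtered_filter_steps:
  assumes "0 \<notin> set S"
  shows "filtered \<tau> G (filter_steps \<tau> S G)"
proof -
  have "filtered \<tau> G (filter_from \<tau> G D S)" if "filtered \<tau> G D" for D
    using that assms by (induction S arbitrary: D) (auto intro: filtered.snoc)
  then show ?thesis by (simp add: filter_steps_def filtered.Nil)
qed

lemma set_filter_steps: "set (filter_steps \<tau> S G) \<subseteq> set S"
proof -
  have "set (filter_from \<tau> G D S) \<subseteq> set D \<union> set S" for D
  proof (induction S arbitrary: D)
    case (Cons s S)
    show ?case using Cons [of "D @ [s]"] Cons [of D] by auto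
  qed simp
  from this [of "[]"] show ?thesis by (simp add: filter_steps_def)
qed

lemma length_filter_steps: "length (filter_steps \<tau> S G) \<le> length S"
proof -
  have "length (filter_from \<tau> G D S) \<le> length D + length S" for D
  proof (induction S arbitrary: D)
    case (Cons s S)
    show ?case using Cons [of "D @ [s]"] Cons [of D] by auto
  qed simp
  from this [of "[]"] show ?thesis by (simp add: filter_steps_def)
qed

lemma col_inv_Nil: "col_inv A [] = 0"
  by (simp add: matrix_eq col_inv_mult_vector)

lemma filter_sigma2_eq_residual:
  fixes G :: "real^'n^'n" and s :: "real^'n"
  assumes "transpose G = G" and "inverse_on G V (col_inv G D)"
  defines "r \<equiv> s - col_inv G D *v (G *v s)"
  shows "filter_sigma2 G D s = r \<bullet> (G *v r)"
  unfolding r_def filter_sigma2_def inverse_on_residual(2) [OF assms(1,2)]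
  by (simp add: col_inv_Nil matrix_vector_mul_assoc [symmetric] symmetric_inner [OF assms(1)])

text \<open>A retained step has positive curvature \<open>\<sigma>\<^sup>2\<close> after projection, so it lies outside the span of its
  predecessors, and the form \<open>G\<close>, only semidefinite on the whole space, stays definite on the span.\<close>
lemma filtered_basis:
  fixes G :: "real^'n^'n"
  assumes G: "pos_semidef G" and \<tau>: "\<tau> > 0" and D: "filtered \<tau> G D"
  shows "distinct D \<and> independent (set D) \<and> pos_def_on (span (set D)) G"
  using D
proof induction
  case Nil
  show ?case by (simp add: pos_def_on_def independent_empty)
next
  case (snoc D s)
  have sym: "transpose G = G" and psd: "\<And>v. 0 \<le> v \<bullet> (G *v v)"
    using G by (auto simp: pos_semidef_def)
  have Z: "inverse_on G (span (set D)) (col_inv G D)"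
    using snoc.IH by (intro inverse_on_col_inv [OF sym]) auto
  define r where "r = s - col_inv G D *v (G *v s)"
  have ZV: "col_inv G D *v v \<in> span (set D)" and ZG: "u \<in> span (set D) \<Longrightarrow> col_inv G D *v (G *v u) = u"
    for u v using Z by (auto simp: inverse_on_def)
  note res = inverse_on_residual [OF sym Z, where s = s, folded r_def]
  have "0 < \<tau> * (norm s)\<^sup>2" using \<tau> snoc.hyps by simp
  also have "\<dots> \<le> r \<bullet> (G *v r)"
    using snoc.hyps by (simp add: r_def filter_sigma2_eq_residual [OF sym Z])
  finally have pos: "0 < r \<bullet> (G *v r)" .
  have s: "s \<notin> span (set D)"
  proof
    assume "s \<in> span (set D)"
    then have "r = 0" by (simp add: r_def ZG)
    then show False using pos by simp
  qed
  have "0 < u \<bullet> (G *v u)" if u: "u \<in> span (insert s (set D))" "u \<noteq> 0" for u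
  proof -
    obtain k where k: "u - k *\<^sub>R s \<in> span (set D)" using u by (auto simp: span_breakdown_eq)
    define w where "w = u - k *\<^sub>R r"
    have "w = (u - k *\<^sub>R s) + k *\<^sub>R (col_inv G D *v (G *v s))" by (simp add: w_def r_def algebra_simps)
    then have w: "w \<in> span (set D)" using k ZV by (simp add: span_add span_scale)
    have uw: "u = w + k *\<^sub>R r" by (simp add: w_def)
    have wr: "w \<bullet> (G *v r) = 0" "r \<bullet> (G *v w) = 0"
      using res(1) [OF w] symmetric_inner [OF sym, of r w] by (simp_all add: inner_commute)
    have eq: "u \<bullet> (G *v u) = w \<bullet> (G *v w) + k\<^sup>2 * (r \<bullet> (G *v r))"
      unfolding uw using wr by (simp add: mat_vec_simps power2_eq_square)
    show ?thesis
    proof (cases "k = 0")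
      case True
      then show ?thesis using snoc.IH w u(2) by (auto simp: pos_def_on_def uw)
    next
      case False
      then show ?thesis using psd [of w] pos by (simp add: eq add_nonneg_pos)
    qed
  qed
  moreover have "s \<notin> set D" using s by (auto intro: span_base)
  ultimately show ?case using snoc.IH s by (auto simp: pos_def_on_def independent_insert)
qed

lemma block_update_eq:
  "block_update B G D = B - B ** col_inv B D ** B + G ** col_inv G D ** G"
  by (simp add: block_update_def col_inv_Nil)

text \<open>Appending \<open>s\<close> to the block amounts to one BFGS update of \<open>C\<close> along the direction \<open>r\<close>. The
  term subtracted in the block formula, \<open>B p p\<^sup>T B / (p \<bullet> B p)\<close>, is the one that BFGS subtracts from \<open>C\<close>,
  because \<open>C r = B p\<close>: the part of \<open>C\<close> that comes from \<open>G\<close> annihilates \<open>r\<close>, and the part that comes from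
  \<open>B\<close> sends \<open>r\<close> and \<open>p\<close> to the same vector, since they differ by an element of the old span.\<close>
lemma block_update_append:
  fixes B G :: "real^'n^'n" and s :: "real^'n"
  assumes B: "pos_def B" and G: "transpose G = G"
    and D: "distinct (D @ [s])" "independent (set (D @ [s]))" "pos_def_on (span (set (D @ [s]))) G"
  defines "p \<equiv> s - col_inv B D *v (B *v s)" and "r \<equiv> s - col_inv G D *v (G *v s)"
    and "C \<equiv> block_update B G D"
  shows "r \<bullet> (C *v r) = p \<bullet> (B *v p)"
    and "block_update B G (D @ [s]) = C - (1 / (r \<bullet> (C *v r))) *\<^sub>R outer (C *v r) (C *v r)
      + (1 / ((G *v r) \<bullet> r)) *\<^sub>R outer (G *v r) (G *v r)"
proof -
  have Bs: "transpose B = B" using B by (simp add: pos_def_def)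
  have sub: "span (set D) \<subseteq> span (set (D @ [s]))" by (rule span_mono) auto
  have D': "distinct D" "independent (set D)" "pos_def_on (span (set D)) G"
    using D sub by (auto simp: pos_def_on_def independent_insert dest: independent_mono)
  have BD: "pos_def_on V B" for V using B by (simp add: pos_def_on_def pos_def_def)
  note ZB = inverse_on_col_inv [OF Bs D'(1,2) BD]
  note ZG = inverse_on_col_inv [OF G D']
  note appB = col_inv_append [OF Bs D(1,2) BD, folded p_def]
  note appG = col_inv_append [OF G D, folded r_def]
  have rp: "r - p \<in> span (set D)"
    using ZB ZG by (auto simp: r_def p_def inverse_on_def intro!: span_diff)
  have ZBr: "col_inv B D *v (B *v r) = r - p"
  proof -
    have "col_inv B D *v (B *v (r - p)) = r - p" using ZB rp by (simp add: inverse_on_def)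
    moreover have "col_inv B D *v (B *v p) = 0"
      unfolding p_def by (rule inverse_on_residual(3) [OF Bs ZB])
    ultimately show ?thesis by (simp add: mat_vec_simps)
  qed
  have ZGr: "col_inv G D *v (G *v r) = 0"
    unfolding r_def by (rule inverse_on_residual(3) [OF G ZG])
  have Cr: "C *v r = B *v p"
    by (simp add: C_def block_update_eq mat_vec_simps ZBr ZGr)
  have "(r - p) \<bullet> (B *v p) = 0"
    unfolding p_def by (rule inverse_on_residual(1) [OF Bs ZB rp [unfolded p_def]])
  then show eq: "r \<bullet> (C *v r) = p \<bullet> (B *v p)"
    by (simp add: Cr inner_diff_left)
  show "block_update B G (D @ [s]) = C - (1 / (r \<bullet> (C *v r))) *\<^sub>R outer (C *v r) (C *v r)
      + (1 / ((G *v r) \<bullet> r)) *\<^sub>R outer (G *v r) (G *v r)"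
    unfolding eq unfolding matrix_eq Cr
    by (simp add: block_update_eq appB(1) appG(1) C_def mat_vec_simps symmetric_inner [OF Bs]
        symmetric_inner [OF G] inner_commute [of r "G *v r"])
qed

text \<open>In each of the successive BFGS updates the determinant is multiplied by \<open>\<sigma>\<^sup>2 / (p \<bullet> B p)\<close>. The filter
  bounds the numerator below by \<open>\<tau> \<parallel>s\<parallel>\<^sup>2\<close>, and the denominator is at most \<open>s \<bullet> B s\<close> because \<open>p\<close> is a
  projection of \<open>s\<close>.\<close>
lemma block_update_pos_def_det:
  fixes B G :: "real^'n^'n"
  assumes B: "pos_def B" and G: "pos_semidef G" and \<tau>: "\<tau> > 0" and D: "filtered \<tau> G D"
  shows "pos_def (block_update B G D) \<and>
    ln \<bar>det B\<bar> + (\<Sum>s\<leftarrow>D. ln (\<tau> * (norm s)\<^sup>2 / (s \<bullet> (B *v s)))) \<le> ln \<bar>det (block_update B G D)\<bar>"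
  using D
proof induction
  case Nil
  show ?case using B by (simp add: block_update_def)
next
  case (snoc D s)
  have Bs: "transpose B = B" using B by (simp add: pos_def_def)
  have Gs: "transpose G = G" using G by (simp add: pos_semidef_def)
  note basis = filtered_basis [OF G \<tau> snoc.hyps(1)]
  have basis': "distinct (D @ [s])" "independent (set (D @ [s]))" "pos_def_on (span (set (D @ [s]))) G"
    using filtered_basis [OF G \<tau> filtered.snoc [OF snoc.hyps]] by blast+
  define p where "p = s - col_inv B D *v (B *v s)"
  define r where "r = s - col_inv G D *v (G *v s)"
  define C where "C = block_update B G D"
  define C' where "C' = block_update B G (D @ [s])"
  have BD: "pos_def_on V B" for V using B by (simp add: pos_def_on_def pos_def_def)
  have ZB: "inverse_on B (span (set D)) (col_inv B D)"
    using basis BD by (intro inverse_on_col_inv [OF Bs]) auto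
  have ZG: "inverse_on G (span (set D)) (col_inv G D)"
    using basis by (intro inverse_on_col_inv [OF Gs]) auto
  note upd = block_update_append [OF B Gs basis', folded p_def r_def C_def C'_def]
  have s: "0 < \<tau> * (norm s)\<^sup>2" using \<tau> snoc.hyps by simp
  have sr: "\<tau> * (norm s)\<^sup>2 \<le> (G *v r) \<bullet> r"
    using snoc.hyps by (simp add: r_def filter_sigma2_eq_residual [OF Gs ZG] inner_commute)
  then have r: "0 < (G *v r) \<bullet> r" using s by linarith
  have p: "0 < p \<bullet> (B *v p)"
    unfolding p_def by (rule col_inv_append(2) [OF Bs basis'(1,2) BD])
  have "pos_semidef B" using B by (metis pos_semidef_def pos_def_def inner_zero_left less_imp_le order_refl)
  then have ps: "p \<bullet> (B *v p) \<le> s \<bullet> (B *v s)"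
    unfolding p_def inverse_on_residual(2) [OF Bs ZB] using inverse_on_energy(1) [OF _ ZB] by simp
  have C: "pos_def C" using snoc.IH by (simp add: C_def)
  note bfgs = bfgs_update [OF C r, folded upd(2)]
  have "det C \<noteq> 0" by (rule pos_def_det_nonzero [OF C])
  then have "ln \<bar>det C'\<bar> = ln \<bar>det C\<bar> + ln (((G *v r) \<bullet> r) / (p \<bullet> (B *v p)))"
    using r p unfolding bfgs(2) upd(1) by (simp add: abs_mult ln_mult ln_div)
  moreover have "\<tau> * (norm s)\<^sup>2 / (s \<bullet> (B *v s)) \<le> ((G *v r) \<bullet> r) / (p \<bullet> (B *v p))"
    using s sr p ps r by (intro frac_le) auto
  then have "ln (\<tau> * (norm s)\<^sup>2 / (s \<bullet> (B *v s))) \<le> ln (((G *v r) \<bullet> r) / (p \<bullet> (B *v p)))"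
    using s p ps by (intro ln_mono) auto
  ultimately show ?case
    using snoc.IH bfgs(1) by (simp add: C_def C'_def)
qed

text \<open>The subtracted matrix \<open>E\<close> is positive semidefinite and agrees with \<open>B\<close> at \<open>s\<close>; the Cauchy-Schwarz
  inequality for the form \<open>E\<close> says that it dominates \<open>(B s) (B s)\<^sup>T / (s \<bullet> B s)\<close>. The added matrix is
  dominated by \<open>G\<close>, as an energy after projection.\<close>
lemma trace_block_update_le:
  fixes B G :: "real^'n^'n"
  assumes B: "pos_def B" and G: "pos_semidef G" and \<tau>: "\<tau> > 0" and D: "filtered \<tau> G D"
    and s: "s \<in> set D"
  shows "trace (block_update B G D) \<le> trace B - (norm (B *v s))\<^sup>2 / (s \<bullet> (B *v s)) + trace G"
proof -
  have Bs: "transpose B = B" using B by (simp add: pos_def_def)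
  have Gs: "transpose G = G" using G by (simp add: pos_semidef_def)
  note basis = filtered_basis [OF G \<tau> D]
  have BD: "pos_def_on V B" for V using B by (simp add: pos_def_on_def pos_def_def)
  have ZB: "inverse_on B (span (set D)) (col_inv B D)"
    using basis BD by (intro inverse_on_col_inv [OF Bs]) auto
  have ZG: "inverse_on G (span (set D)) (col_inv G D)"
    using basis by (intro inverse_on_col_inv [OF Gs]) auto
  have Bpsd: "pos_semidef B" using B by (metis pos_semidef_def pos_def_def inner_zero_left less_imp_le order_refl)
  have G_le: "trace (G ** col_inv G D ** G) \<le> trace G"
    using inverse_on_energy(2) [OF G ZG]
    by (intro trace_mono) (simp add: matrix_vector_mul_assoc [symmetric] symmetric_inner [OF Gs])
  have "s \<noteq> 0" using basis s by (metis dependent_zero)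
  then have b: "0 < s \<bullet> (B *v s)" using B by (simp add: pos_def_def)
  let ?E = "B ** col_inv B D ** B"
  have Es: "?E *v s = B *v s"
    using ZB s by (simp add: matrix_vector_mul_assoc [symmetric] inverse_on_def span_base)
  have Esym: "w \<bullet> (?E *v v) = (?E *v w) \<bullet> v" for v w
    using ZB by (simp add: matrix_vector_mul_assoc [symmetric] inverse_on_def symmetric_inner [OF Bs] symmetric_inner)
  have Epsd: "0 \<le> w \<bullet> (?E *v w)" for w
    using inverse_on_energy(1) [OF Bpsd ZB]
    by (simp add: matrix_vector_mul_assoc [symmetric] symmetric_inner [OF Bs])
  have "w \<bullet> (((1 / (s \<bullet> (B *v s))) *\<^sub>R outer (B *v s) (B *v s)) *v w) \<le> w \<bullet> (?E *v w)" for w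
  proof -
    define b where "b = s \<bullet> (B *v s)"
    define t where "t = (B *v s) \<bullet> w / b"
    have sE: "s \<bullet> (?E *v w) = (B *v s) \<bullet> w" by (simp add: Esym Es)
    have "0 \<le> (w - t *\<^sub>R s) \<bullet> (?E *v (w - t *\<^sub>R s))" by (rule Epsd)
    also have "\<dots> = w \<bullet> (?E *v w) - 2 * t * ((B *v s) \<bullet> w) + t\<^sup>2 * b"
      by (simp only: matrix_vector_mult_diff_distrib matrix_vector_mult_scaleR Es)
        (simp add: inner_diff_left inner_diff_right sE inner_commute [of w] b_def power2_eq_square algebra_simps)
    also have "\<dots> = w \<bullet> (?E *v w) - ((B *v s) \<bullet> w)\<^sup>2 / b"
      using b by (simp add: t_def b_def [symmetric] field_simps power2_eq_square)
    finally show ?thesis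
      by (simp add: mat_vec_simps b_def power2_eq_square inner_commute)
  qed
  then have "trace ((1 / (s \<bullet> (B *v s))) *\<^sub>R outer (B *v s) (B *v s)) \<le> trace ?E"
    by (rule trace_mono)
  then show ?thesis
    using G_le by (simp add: block_update_eq trace_add trace_sub trace_scaleR trace_outer power2_norm_eq_inner)
qed

section \<open>Trace minus logarithm of the determinant\<close>

text \<open>The quantity of Byrd and Nocedal. With the absolute value, invertibility is all that has to be known
  about the determinant.\<close>
definition merit :: "real^'n^'n \<Rightarrow> real" where
  "merit B = trace B - ln \<bar>det B\<bar>"

text \<open>The test vectors \<open>e\<^sub>i + e\<^sub>j\<close> and \<open>e\<^sub>i - e\<^sub>j\<close> bound \<open>2 |B\<^sub>i\<^sub>j|\<close> by \<open>B\<^sub>i\<^sub>i + B\<^sub>j\<^sub>j\<close>.\<close>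
lemma pos_def_entry_le_trace:
  fixes B :: "real^'n^'n"
  assumes B: "pos_def B"
  shows "\<bar>B $ i $ j\<bar> \<le> trace B"
proof -
  have Bs: "transpose B = B" using B by (simp add: pos_def_def)
  have psd: "0 \<le> v \<bullet> (B *v v)" for v
    using B by (metis pos_def_def inner_zero_left less_imp_le order_refl)
  have entry: "axis a 1 \<bullet> (B *v axis b 1) = B $ a $ b" for a b
    by (simp add: inner_axis' matrix_vector_mult_basis column_def)
  have sym: "B $ j $ i = B $ i $ j"
    using arg_cong [OF Bs, of "\<lambda>A. A $ i $ j"] by (simp add: transpose_def)
  have diag: "B $ a $ a \<le> trace B" for a
    unfolding trace_def by (rule member_le_sum) (use psd in \<open>auto simp: diag_eq_inner\<close>)
  have "0 \<le> B $ i $ i + 2 * B $ i $ j + B $ j $ j"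
    using psd [of "axis i 1 + axis j 1"] by (simp add: mat_vec_simps entry sym)
  moreover have "0 \<le> B $ i $ i - 2 * B $ i $ j + B $ j $ j"
    using psd [of "axis i 1 - axis j 1"] by (simp add: mat_vec_simps entry sym)
  ultimately show ?thesis using diag [of i] diag [of j] by linarith
qed

text \<open>No entry exceeds the trace \<open>t\<close>, so the Leibniz formula bounds the determinant by \<open>n! t\<^sup>n\<close>, and \<open>t - n ln t\<close>
  is bounded below.\<close>
lemma merit_bounded_below:
  obtains c where "\<And>B :: real^'n^'n. pos_def B \<Longrightarrow> c \<le> merit B"
proof
  fix B :: "real^'n^'n"
  assume B: "pos_def B"
  define n where "n = real CARD('n)"
  define t where "t = trace B"
  have n: "n > 0" by (simp add: n_def)
  have det0: "det B \<noteq> 0" by (rule pos_def_det_nonzero [OF B])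
  let ?P = "{p. p permutes (UNIV :: 'n set)}"
  have "\<bar>det B\<bar> \<le> (\<Sum>p\<in>?P. \<bar>of_int (sign p) * (\<Prod>i\<in>UNIV. B $ i $ p i)\<bar>)"
    unfolding Determinants.det_def by (rule sum_abs)
  also have "\<dots> \<le> (\<Sum>p\<in>?P. t ^ CARD('n))"
  proof (rule sum_mono)
    fix p
    have "\<bar>of_int (sign p) * (\<Prod>i\<in>UNIV. B $ i $ p i)\<bar> = (\<Prod>i\<in>UNIV. \<bar>B $ i $ p i\<bar>)"
      by (simp add: abs_mult abs_prod sign_def)
    also have "\<dots> \<le> (\<Prod>i\<in>(UNIV :: 'n set). t)"
      by (rule prod_mono) (simp add: t_def pos_def_entry_le_trace [OF B])
    finally show "\<bar>of_int (sign p) * (\<Prod>i\<in>UNIV. B $ i $ p i)\<bar> \<le> t ^ CARD('n)" by simp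
  qed
  also have "\<dots> = fact CARD('n) * t ^ CARD('n)"
    by (simp add: card_permutations)
  finally have le: "\<bar>det B\<bar> \<le> fact CARD('n) * t ^ CARD('n)" .
  have "t \<noteq> 0" using le det0 by (auto simp: power_0_left)
  moreover have "0 \<le> t" unfolding t_def using pos_def_entry_le_trace [OF B] by (meson abs_ge_zero order_trans)
  ultimately have t: "t > 0" by simp
  have "ln \<bar>det B\<bar> \<le> ln (fact CARD('n) * t ^ CARD('n))"
    using le det0 by (intro ln_mono) auto
  also have "\<dots> = ln (fact CARD('n)) + n * ln t"
    using t by (simp add: ln_mult ln_realpow n_def)
  also have "ln t = ln (t / n) + ln n" using t n by (simp add: ln_div)
  also have "ln (t / n) \<le> t / n" using ln_le_minus_one [of "t / n"] t n by simp
  finally have "ln \<bar>det B\<bar> \<le> ln (fact CARD('n)) + n * (t / n + ln n)" using n by simp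
  then show "- (ln (fact CARD('n)) + n * ln n) \<le> merit B"
    using n by (simp add: merit_def t_def [symmetric] algebra_simps)
qed

text \<open>The trace falls by at least \<open>a\<^sub>s = \<parallel>B s\<parallel>\<^sup>2 / (s \<bullet> B s)\<close> only once, for the largest of these numbers,
  whereas the logarithm of the determinant loses up to \<open>ln a\<^sub>s\<close> for each of at most \<open>q\<close> steps. The
  estimate \<open>ln a \<le> a / q + ln q\<close> lets each step use up a share \<open>1 / q\<close> of the fall of the trace, and the
  constant \<open>K\<close> covers everything else.\<close>
lemma merit_decrease:
  fixes B G :: "real^'n^'n"
  assumes B: "pos_def B" and G: "pos_semidef G" and T: "trace G \<le> T" and \<tau>: "\<tau> > 0"
    and D: "filtered \<tau> G D" "D \<noteq> []" "length D \<le> q"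
    and K: "K > 0" "ln K \<ge> T + 1 + ln q - ln \<tau>"
    and angle: "\<And>s. s \<in> set D \<Longrightarrow> K * (s \<bullet> (B *v s))\<^sup>2 \<le> (norm (B *v s))\<^sup>2 * (norm s)\<^sup>2"
  shows "merit (block_update B G D) \<le> merit B - 1"
proof -
  define B' where "B' = block_update B G D"
  define \<Delta> where "\<Delta> = trace B + trace G - trace B'"
  have q: "real q > 0" using D by (cases D) auto
  have T0: "0 \<le> T"
    using T G trace_mono [of 0 G] by (auto simp: pos_semidef_def trace_def)
  \<comment> \<open>\<open>\<Delta>\<close> is an upper bound for every \<open>a\<^sub>s\<close>, so that no maximum has to be taken.\<close>
  have each: "0 \<le> \<Delta> \<and> T + 1 - \<Delta> / q \<le> ln (\<tau> * (norm s)\<^sup>2 / (s \<bullet> (B *v s)))"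
    if s: "s \<in> set D" for s
  proof -
    define b where "b = s \<bullet> (B *v s)"
    define a where "a = (norm (B *v s))\<^sup>2 / b"
    define c where "c = (norm s)\<^sup>2 / b"
    have s0: "s \<noteq> 0" using filtered_basis [OF G \<tau> D(1)] s by (metis dependent_zero)
    then have b: "b > 0" using B by (simp add: pos_def_def b_def)
    then have "B *v s \<noteq> 0" by (auto simp: b_def)
    then have a: "a > 0" and c: "c > 0" using s0 b by (auto simp: a_def c_def)
    have a\<Delta>: "a \<le> \<Delta>"
      using trace_block_update_le [OF B G \<tau> D(1) s] by (simp add: a_def b_def \<Delta>_def B'_def)
    have "K \<le> a * c"
      using angle [OF s] b by (simp add: a_def c_def b_def [symmetric] field_simps power2_eq_square)
    then have "ln K \<le> ln (a * c)" using K(1) by (intro ln_mono) auto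
    then have "ln K \<le> ln a + ln c" using a c by (simp add: ln_mult)
    moreover have "ln a \<le> a / q + ln q"
      using ln_le_minus_one [of "a / q"] a q by (simp add: ln_div)
    moreover have "a / q \<le> \<Delta> / q" using a\<Delta> q by (simp add: divide_right_mono)
    moreover have "ln (\<tau> * c) = ln \<tau> + ln c" using \<tau> c by (simp add: ln_mult)
    ultimately have "T + 1 - \<Delta> / q \<le> ln (\<tau> * c)" using K(2) by linarith
    then show ?thesis using a a\<Delta> by (simp add: c_def b_def)
  qed
  have \<Delta>: "0 \<le> \<Delta>" using each D(2) by (cases D) auto
  have len: "1 \<le> real (length D)" using D(2) by (cases D) auto
  have "T + 1 - \<Delta> \<le> real (length D) * (T + 1) - real (length D) * (\<Delta> / q)"
  proof -
    have "1 * (T + 1) \<le> real (length D) * (T + 1)" using len T0 by (intro mult_right_mono) auto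
    moreover have "real (length D) * (\<Delta> / q) \<le> real q * (\<Delta> / q)"
      using D(3) \<Delta> by (intro mult_right_mono) auto
    ultimately show ?thesis using q by simp
  qed
  also have "\<dots> = (\<Sum>s\<leftarrow>D. T + 1 - \<Delta> / q)"
    by (simp add: sum_list_const_mult sum_list_triv algebra_simps)
  also have "\<dots> \<le> (\<Sum>s\<leftarrow>D. ln (\<tau> * (norm s)\<^sup>2 / (s \<bullet> (B *v s))))"
    by (rule sum_list_mono) (use each in auto)
  also have "\<dots> \<le> ln \<bar>det B'\<bar> - ln \<bar>det B\<bar>"
    using block_update_pos_def_det [OF B G \<tau> D(1)] by (simp add: B'_def)
  finally show ?thesis using T by (simp add: merit_def \<Delta>_def B'_def [symmetric])
qed

text \<open>Both factors are compared with their extreme values on the compact unit sphere; adding 1 to the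
  resulting constant makes the inequality strict.\<close>
lemma pos_def_angle_bounded:
  fixes B :: "real^'n^'n"
  assumes B: "pos_def B"
  obtains K where "\<And>s. s \<noteq> 0 \<Longrightarrow> (norm (B *v s))\<^sup>2 * (norm s)\<^sup>2 < K * (s \<bullet> (B *v s))\<^sup>2"
proof -
  let ?S = "sphere (0 :: real^'n) 1"
  have cont: "continuous_on ?S ((*v) B)"
    by (intro linear_continuous_on linear_conv_bounded_linear [THEN iffD1]) auto
  have "\<exists>u\<in>?S. \<forall>v\<in>?S. (u \<bullet> (B *v u)) \<le> v \<bullet> (B *v v)"
    using cont by (intro continuous_attains_inf continuous_intros) auto
  then obtain u where u: "u \<in> ?S" "\<And>v. v \<in> ?S \<Longrightarrow> u \<bullet> (B *v u) \<le> v \<bullet> (B *v v)" by blast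
  have "\<exists>w\<in>?S. \<forall>v\<in>?S. norm (B *v v) \<le> norm (B *v w)"
    using cont by (intro continuous_attains_sup continuous_intros) auto
  then obtain w where w: "w \<in> ?S" "\<And>v. v \<in> ?S \<Longrightarrow> norm (B *v v) \<le> norm (B *v w)" by blast
  define m where "m = u \<bullet> (B *v u)"
  define L where "L = norm (B *v w)"
  have "u \<noteq> 0" using u(1) by auto
  then have m: "m > 0" using B by (simp add: pos_def_def m_def)
  have "(norm (B *v s))\<^sup>2 * (norm s)\<^sup>2 < (L\<^sup>2 / m\<^sup>2 + 1) * (s \<bullet> (B *v s))\<^sup>2" if s: "s \<noteq> 0" for s
  proof -
    define v where "v = (1 / norm s) *\<^sub>R s"
    have v: "v \<in> ?S" using s by (simp add: v_def)
    have sv: "s = norm s *\<^sub>R v" using s by (simp add: v_def)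
    define e where "e = v \<bullet> (B *v v)"
    have e: "m \<le> e" using u(2) [OF v] by (simp add: m_def e_def)
    have eq1: "(norm (B *v s))\<^sup>2 * (norm s)\<^sup>2 = norm s ^ 4 * (norm (B *v v))\<^sup>2"
      by (subst (1) sv) (simp add: matrix_vector_mult_scaleR power_mult_distrib power4_eq_xxxx power2_eq_square)
    have eq2: "(s \<bullet> (B *v s))\<^sup>2 = norm s ^ 4 * e\<^sup>2"
      by (subst (1 2) sv) (simp add: e_def matrix_vector_mult_scaleR power_mult_distrib power4_eq_xxxx power2_eq_square)
    have "(norm (B *v v))\<^sup>2 \<le> L\<^sup>2" using w(2) [OF v] by (simp add: L_def power_mono)
    also have "\<dots> = (L\<^sup>2 / m\<^sup>2) * m\<^sup>2" using m by simp
    also have "\<dots> \<le> (L\<^sup>2 / m\<^sup>2) * e\<^sup>2" using e m by (intro mult_left_mono power_mono) auto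
    also have "\<dots> < (L\<^sup>2 / m\<^sup>2 + 1) * e\<^sup>2" using e m by (simp add: distrib_right)
    finally have "norm s ^ 4 * (norm (B *v v))\<^sup>2 < norm s ^ 4 * ((L\<^sup>2 / m\<^sup>2 + 1) * e\<^sup>2)"
      using s by (intro mult_strict_left_mono) auto
    then show ?thesis unfolding eq1 eq2 by (simp add: mult_ac)
  qed
  then show ?thesis using that by blast
qed

text \<open>If for every \<open>K\<close> the reverse inequality held from some point on, each update with a nonempty list of
  retained steps would eventually lower \<open>merit\<close> by 1. As \<open>merit\<close> is bounded below, the matrices would
  become constant, and \<open>pos_def_angle_bounded\<close> applies to the constant matrix.\<close>
lemma block_updates_angle_condition:
  fixes B G :: "nat \<Rightarrow> real^'n^'n" and S :: "nat \<Rightarrow> (real^'n) list"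
  assumes \<tau>: "\<tau> > 0"
    and B: "\<And>k. k \<ge> 1 \<Longrightarrow> pos_def (B k)"
    and G: "\<And>k. k \<ge> 1 \<Longrightarrow> pos_semidef (G k) \<and> trace (G k) \<le> T"
    and S: "\<And>k. k \<ge> 1 \<Longrightarrow> 0 \<notin> set (S k) \<and> S k \<noteq> [] \<and> length (S k) \<le> q"
    and upd: "\<And>k. k \<ge> 1 \<Longrightarrow> B (k + 1) = block_update (B k) (G k) (filter_steps \<tau> (S k) (G k))"
  obtains K where "\<And>k0. \<exists>k\<ge>k0. k \<ge> 1 \<and> (\<exists>s\<in>set (S k).
    (norm (B k *v s))\<^sup>2 * (norm s)\<^sup>2 < K * (s \<bullet> (B k *v s))\<^sup>2)"
proof (rule ccontr)
  assume "\<not> thesis"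
  then have ev: "\<exists>k0. \<forall>k\<ge>k0. k \<ge> 1 \<longrightarrow> (\<forall>s\<in>set (S k).
      K * (s \<bullet> (B k *v s))\<^sup>2 \<le> (norm (B k *v s))\<^sup>2 * (norm s)\<^sup>2)" for K
    using that [of K] by (meson not_le)
  let ?D = "\<lambda>k. filter_steps \<tau> (S k) (G k)"
  define K where "K = exp (T + 1 + ln q - ln \<tau>)"
  obtain k0 where k0: "\<And>k s. k \<ge> k0 \<Longrightarrow> k \<ge> 1 \<Longrightarrow> s \<in> set (S k) \<Longrightarrow>
      K * (s \<bullet> (B k *v s))\<^sup>2 \<le> (norm (B k *v s))\<^sup>2 * (norm s)\<^sup>2"
    using ev [of K] by blast
  define \<psi> where "\<psi> j = merit (B (j + k0 + 1))" for j
  have drop: "(?D (j + k0 + 1) = [] \<and> \<psi> (Suc j) = \<psi> j) \<or> \<psi> (Suc j) \<le> \<psi> j - 1" for j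
  proof -
    let ?k = "j + k0 + 1"
    have k: "?k \<ge> 1" "?k \<ge> k0" by auto
    have B': "B (Suc j + k0 + 1) = block_update (B ?k) (G ?k) (?D ?k)"
      using upd [OF k(1)] by simp
    show ?thesis
    proof (cases "?D ?k = []")
      case True
      then show ?thesis by (simp add: \<psi>_def B' [simplified] block_update_def)
    next
      case False
      have "merit (block_update (B ?k) (G ?k) (?D ?k)) \<le> merit (B ?k) - 1"
      proof (rule merit_decrease [OF B [OF k(1)] _ _ \<tau> _ False])
        show "length (?D ?k) \<le> q" using S [OF k(1)] length_filter_steps order_trans by blast
        show "filtered \<tau> (G ?k) (?D ?k)" using S [OF k(1)] filtered_filter_steps by blast
        show "K * (s \<bullet> (B ?k *v s))\<^sup>2 \<le> (norm (B ?k *v s))\<^sup>2 * (norm s)\<^sup>2" if "s \<in> set (?D ?k)" for s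
          using k0 [OF k(2,1)] that set_filter_steps by blast
      qed (use G [OF k(1)] in \<open>auto simp: K_def\<close>)
      then show ?thesis by (simp add: \<psi>_def B' [simplified])
    qed
  qed
  have "decseq \<psi>"
  proof (rule decseq_SucI)
    show "\<psi> (Suc j) \<le> \<psi> j" for j using drop [of j] by linarith
  qed
  obtain c where c: "\<And>B :: real^'n^'n. pos_def B \<Longrightarrow> c \<le> merit B" using merit_bounded_below by blast
  have "\<forall>j. c \<le> \<psi> j" using c B by (simp add: \<psi>_def)
  then obtain L where "\<psi> \<longlonglongrightarrow> L"
    using decseq_convergent [OF \<open>decseq \<psi>\<close>] by blast
  then have "(\<lambda>j. \<psi> j - \<psi> (Suc j)) \<longlonglongrightarrow> L - L"
    by (intro tendsto_diff LIMSEQ_Suc)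
  then have "\<forall>\<^sub>F j in sequentially. \<psi> j - \<psi> (Suc j) < 1"
    by (intro order_tendstoD) auto
  then obtain j0 where j0: "\<And>j. j \<ge> j0 \<Longrightarrow> \<psi> j - \<psi> (Suc j) < 1"
    by (auto simp: eventually_sequentially)
  define k1 where "k1 = j0 + k0 + 1"
  have const: "B k = B k1" if "k \<ge> k1" for k
    using that
  proof (induction k rule: dec_induct)
    case (step k)
    define j where "j = k - k0 - 1"
    have j: "k = j + k0 + 1" "j \<ge> j0" using step.hyps by (auto simp: j_def k1_def)
    have "?D k = []" using drop [of j] j0 [OF j(2)] unfolding j(1) by linarith
    then have "B (k + 1) = B k" using upd [of k] step.hyps by (simp add: k1_def block_update_def)
    then show ?case using step.IH by simp
  qed simp
  have k1: "k1 \<ge> 1" by (simp add: k1_def)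
  obtain K' where K': "\<And>s. s \<noteq> 0 \<Longrightarrow> (norm (B k1 *v s))\<^sup>2 * (norm s)\<^sup>2 < K' * (s \<bullet> (B k1 *v s))\<^sup>2"
    using pos_def_angle_bounded [OF B [OF k1]] by blast
  obtain k2 where k2: "\<And>k s. k \<ge> k2 \<Longrightarrow> k \<ge> 1 \<Longrightarrow> s \<in> set (S k) \<Longrightarrow>
      K' * (s \<bullet> (B k *v s))\<^sup>2 \<le> (norm (B k *v s))\<^sup>2 * (norm s)\<^sup>2"
    using ev [of K'] by blast
  define k where "k = max k1 k2"
  have k: "k \<ge> k1" "k \<ge> k2" "k \<ge> 1" using k1 by (auto simp: k_def)
  obtain s where s: "s \<in> set (S k)" "s \<noteq> 0" using S [OF k(3)] by (metis list.set_intros(1) neq_Nil_conv)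
  show False using k2 [OF k(2,3) s(1)] K' [OF s(2)] unfolding const [OF k(1)] by linarith
qed

section \<open>Convex functions with bounded Hessian\<close>

lemma has_derivative_gradient:
  fixes f :: "real^'n \<Rightarrow> real"
  assumes "f differentiable (at x)"
  shows "(f has_derivative (\<lambda>h. h \<bullet> gradient f x)) (at x)"
proof -
  obtain f' where f': "(f has_derivative f') (at x)" using assms by (auto simp: differentiable_def)
  interpret f': bounded_linear f' by (rule has_derivative_bounded_linear [OF f'])
  define v where "v = (\<Sum>b\<in>Basis. f' b *\<^sub>R b)"
  have "f' h = h \<bullet> v" for h
  proof -
    have "f' h = f' (\<Sum>b\<in>Basis. (h \<bullet> b) *\<^sub>R b)" by (simp add: euclidean_representation)
    also have "\<dots> = h \<bullet> v"
      by (simp only: f'.sum f'.scaleR v_def inner_sum_right) (simp add: mult.commute)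
    finally show ?thesis .
  qed
  then have "f' = (\<lambda>h. h \<bullet> v)" by (rule ext)
  then have v: "GDERIV f x :> v" using f' by (simp add: gderiv_def)
  have "gradient f x = v" unfolding gradient_def
  proof (rule the_equality)
    show "GDERIV f x :> v" by (rule v)
    fix w assume "GDERIV f x :> w"
    then have "(\<lambda>h. h \<bullet> w) = (\<lambda>h. h \<bullet> v)"
      using v unfolding gderiv_def by (rule has_derivative_unique)
    then show "w = v" by (metis vector_eq_ldot)
  qed
  then show ?thesis using v by (simp add: gderiv_def)
qed

lemma directional_derivative:
  fixes f :: "real^'n \<Rightarrow> real"
  assumes "f differentiable (at (x + t *\<^sub>R h))"
  shows "((\<lambda>t. f (x + t *\<^sub>R h)) has_real_derivative gradient f (x + t *\<^sub>R h) \<bullet> h) (at t)"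
proof -
  have "((\<lambda>t. f (x + t *\<^sub>R h)) has_derivative (\<lambda>u. (u *\<^sub>R h) \<bullet> gradient f (x + t *\<^sub>R h))) (at t)"
    by (rule has_derivative_compose [where f = "\<lambda>t. x + t *\<^sub>R h", OF _ has_derivative_gradient [OF assms]])
      (auto intro!: derivative_eq_intros)
  then show ?thesis
    by (rule has_derivative_imp_has_field_derivative) (simp add: inner_commute)
qed

lemma gradient_directional_derivative:
  fixes f :: "real^'n \<Rightarrow> real"
  assumes "gradient f differentiable (at (x + t *\<^sub>R h))"
  shows "((\<lambda>t. gradient f (x + t *\<^sub>R h) \<bullet> h) has_real_derivative
    h \<bullet> (hessian f (x + t *\<^sub>R h) *v h)) (at t)"
proof -
  have "((\<lambda>t. gradient f (x + t *\<^sub>R h)) has_derivative (\<lambda>u. hessian f (x + t *\<^sub>R h) *v (u *\<^sub>R h))) (at t)"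
    unfolding hessian_def
    by (rule has_derivative_compose [where f = "\<lambda>t. x + t *\<^sub>R h", OF _ assms [unfolded jacobian_works]])
      (auto intro!: derivative_eq_intros)
  then have "((\<lambda>t. gradient f (x + t *\<^sub>R h) \<bullet> h) has_derivative
      (\<lambda>u. (hessian f (x + t *\<^sub>R h) *v (u *\<^sub>R h)) \<bullet> h)) (at t)"
    by (rule has_derivative_inner_left)
  then show ?thesis
    by (rule has_derivative_imp_has_field_derivative)
      (simp add: matrix_vector_mult_scaleR inner_commute)
qed

lemma convex_gradient_monotone:
  fixes f :: "real^'n \<Rightarrow> real"
  assumes f: "convex_on UNIV f" and d: "\<And>x. f differentiable (at x)"
  shows "mono (\<lambda>t. gradient f (x + t *\<^sub>R h) \<bullet> h)"
proof -
  define \<phi> where "\<phi> t = f (x + t *\<^sub>R h)" for t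
  have conv: "convex_on UNIV \<phi>"
  proof (rule convex_onI)
    fix t a b :: real
    assume "0 < t" "t < 1"
    then have "f ((1 - t) *\<^sub>R (x + a *\<^sub>R h) + t *\<^sub>R (x + b *\<^sub>R h))
        \<le> (1 - t) * f (x + a *\<^sub>R h) + t * f (x + b *\<^sub>R h)"
      by (intro convex_onD [OF f]) auto
    also have "(1 - t) *\<^sub>R (x + a *\<^sub>R h) + t *\<^sub>R (x + b *\<^sub>R h) = x + ((1 - t) *\<^sub>R a + t *\<^sub>R b) *\<^sub>R h"
      by (simp add: algebra_simps)
    finally show "\<phi> ((1 - t) *\<^sub>R a + t *\<^sub>R b) \<le> (1 - t) * \<phi> a + t * \<phi> b" by (simp add: \<phi>_def)
  qed simp
  define \<phi>' where "\<phi>' t = gradient f (x + t *\<^sub>R h) \<bullet> h" for t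
  have "\<phi> b - \<phi> a \<ge> \<phi>' a * (b - a)" for a b
    unfolding \<phi>'_def
    by (rule convex_on_imp_above_tangent [OF conv])
      (auto simp: \<phi>_def [abs_def] intro!: directional_derivative d)
  then have "\<phi>' a * (b - a) \<le> \<phi> b - \<phi> a" "\<phi>' b * (a - b) \<le> \<phi> a - \<phi> b" for a b
    by blast+
  then have "\<phi>' a * (b - a) + \<phi>' b * (a - b) \<le> 0" for a b
    using add_mono [of "\<phi>' a * (b - a)" "\<phi> b - \<phi> a" "\<phi>' b * (a - b)" "\<phi> a - \<phi> b"] by simp
  then have "\<phi>' a * (b - a) \<le> \<phi>' b * (b - a)" for a b
    by (simp add: algebra_simps)
  then have "\<phi>' a \<le> \<phi>' b" if "a \<le> b" for a b
    using that by (cases "a = b") (auto simp: mult_le_cancel_right)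
  then show ?thesis by (simp add: mono_def \<phi>'_def)
qed

text \<open>The symmetry of the Hessian is part of the Loewner bound, in which the difference of the two sides is
  symmetric. Nonnegativity of \<open>h \<bullet> G h\<close> holds because it is the
  derivative of a monotone function.\<close>
lemma hessian_pos_semidef:
  fixes f :: "real^'n \<Rightarrow> real"
  assumes f: "convex_on UNIV f" "twice_differentiable f"
    and le: "loewner_le (hessian f x) (M *\<^sub>R Finite_Cartesian_Product.mat 1)"
  shows "pos_semidef (hessian f x)"
proof -
  have "0 \<le> h \<bullet> (hessian f x *v h)" for h
  proof (rule mono_on_imp_deriv_nonneg)
    have "((\<lambda>t. gradient f (x + t *\<^sub>R h) \<bullet> h) has_real_derivative
        h \<bullet> (hessian f (x + 0 *\<^sub>R h) *v h)) (at 0)"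
      by (rule gradient_directional_derivative) (use f in \<open>simp add: twice_differentiable_def\<close>)
    then show "((\<lambda>t. gradient f (x + t *\<^sub>R h) \<bullet> h) has_real_derivative h \<bullet> (hessian f x *v h)) (at 0)"
      by simp
    show "mono_on UNIV (\<lambda>t. gradient f (x + t *\<^sub>R h) \<bullet> h)"
      using convex_gradient_monotone [OF f(1)] f(2) by (simp add: twice_differentiable_def)
  qed simp
  moreover have "transpose (hessian f x) = hessian f x"
    using le unfolding loewner_le_def pos_semidef_def symmetric_iff_inner
    by (simp add: mat_vec_simps)
  ultimately show ?thesis by (simp add: pos_semidef_def)
qed

lemma loewner_le_quadratic:
  "loewner_le A (M *\<^sub>R Finite_Cartesian_Product.mat 1) \<Longrightarrow> v \<bullet> (A *v v) \<le> M * (norm v)\<^sup>2"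
  by (simp add: loewner_le_def pos_semidef_def mat_vec_simps power2_norm_eq_inner)

lemma loewner_le_trace:
  fixes A :: "real^'n^'n"
  assumes "loewner_le A (M *\<^sub>R Finite_Cartesian_Product.mat 1)"
  shows "trace A \<le> M * CARD('n)"
proof -
  have "trace A \<le> trace (M *\<^sub>R Finite_Cartesian_Product.mat 1 :: real^'n^'n)"
    using loewner_le_quadratic [OF assms]
    by (intro trace_mono) (simp add: mat_vec_simps power2_norm_eq_inner)
  then show ?thesis by (simp add: trace_scaleR trace_I)
qed

text \<open>The mean value theorem is applied on the segment between the two points, which by convexity does not
  leave the level set.\<close>
lemma gradient_difference_le:
  fixes f :: "real^'n \<Rightarrow> real"
  assumes f: "convex_on UNIV f" "twice_differentiable f"
    and M: "\<forall>y\<in>{y. f y \<le> c}. loewner_le (hessian f y) (M *\<^sub>R Finite_Cartesian_Product.mat 1)"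
    and x: "f x \<le> c" "f (x + s) \<le> c"
  shows "gradient f (x + s) \<bullet> s - gradient f x \<bullet> s \<le> M * (norm s)\<^sup>2"
proof -
  define \<phi> where "\<phi> t = gradient f (x + t *\<^sub>R s) \<bullet> s" for t
  have "\<exists>z>0. z < 1 \<and> \<phi> 1 - \<phi> 0 = (1 - 0) * (s \<bullet> (hessian f (x + z *\<^sub>R s) *v s))"
    unfolding \<phi>_def
    by (rule MVT2, simp, rule gradient_directional_derivative)
      (use f in \<open>simp add: twice_differentiable_def\<close>)
  then obtain z where z: "0 < z" "z < 1" "\<phi> 1 - \<phi> 0 = s \<bullet> (hessian f (x + z *\<^sub>R s) *v s)" by auto
  have "x + z *\<^sub>R s = (1 - z) *\<^sub>R x + z *\<^sub>R (x + s)" by (simp add: algebra_simps)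
  then have "f (x + z *\<^sub>R s) \<le> (1 - z) * f x + z * f (x + s)"
    using convex_onD [OF f(1), of z x "x + s"] z by simp
  also have "\<dots> \<le> (1 - z) * c + z * c" using x z by (intro add_mono mult_left_mono) auto
  finally have "f (x + z *\<^sub>R s) \<le> c" by (simp add: algebra_simps)
  then have "s \<bullet> (hessian f (x + z *\<^sub>R s) *v s) \<le> M * (norm s)\<^sup>2"
    using M by (intro loewner_le_quadratic) auto
  then show ?thesis using z by (simp add: \<phi>_def)
qed

text \<open>The Wolfe condition forces the slope to change by \<open>(1 - \<beta>) |g \<bullet> s|\<close>, and the bound on the Hessian
  allows a change of at most \<open>M \<parallel>s\<parallel>\<^sup>2\<close>; so \<open>s\<close> is not too short, and the Armijo condition turns this
  into a decrease of \<open>f\<close>.\<close>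
lemma armijo_wolfe_decrease:
  fixes f :: "real^'n \<Rightarrow> real"
  assumes f: "convex_on UNIV f" "twice_differentiable f"
    and M: "M > 0" "\<forall>y\<in>{y. f y \<le> c}. loewner_le (hessian f y) (M *\<^sub>R Finite_Cartesian_Product.mat 1)"
    and par: "0 < \<alpha>" "\<beta> < 1"
    and x: "f x \<le> c" and l: "l > 0" and desc: "gradient f x \<bullet> d < 0"
    and aw: "armijo_wolfe f \<alpha> \<beta> x d l"
  defines "s \<equiv> l *\<^sub>R d"
  shows "f (x + s) \<le> f x - \<alpha> * (1 - \<beta>) / M * ((gradient f x \<bullet> s)\<^sup>2 / (norm s)\<^sup>2)"
    and "f (x + s) \<le> f x"
proof -
  define g where "g = - (gradient f x \<bullet> s)"
  have g: "g > 0" using desc l by (simp add: g_def s_def mult_pos_neg)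
  have "s \<noteq> 0" using g by (auto simp: g_def)
  then have s: "(norm s)\<^sup>2 > 0" by simp
  have armijo: "f (x + s) \<le> f x - \<alpha> * g"
    using aw by (simp add: armijo_wolfe_def s_def g_def algebra_simps)
  then show le: "f (x + s) \<le> f x" using mult_pos_pos [OF par(1) g] by linarith
  have "l * (\<beta> * (gradient f x \<bullet> d)) \<le> l * (gradient f (x + s) \<bullet> d)"
    using aw l by (intro mult_left_mono) (auto simp: armijo_wolfe_def s_def)
  then have "(1 - \<beta>) * g \<le> gradient f (x + s) \<bullet> s - gradient f x \<bullet> s"
    by (simp add: g_def s_def algebra_simps)
  also have "\<dots> \<le> M * (norm s)\<^sup>2"
    using gradient_difference_le [OF f M(2) x, of s] le x by linarith
  finally have "(1 - \<beta>) * g * (g / (norm s)\<^sup>2) \<le> M * (norm s)\<^sup>2 * (g / (norm s)\<^sup>2)"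
    using g s by (intro mult_right_mono) auto
  then have "(1 - \<beta>) * (g\<^sup>2 / (norm s)\<^sup>2) \<le> M * g"
    using s by (simp add: power2_eq_square [of g] mult_ac)
  then have "\<alpha> / M * ((1 - \<beta>) * (g\<^sup>2 / (norm s)\<^sup>2)) \<le> \<alpha> / M * (M * g)"
    using par M by (intro mult_left_mono) auto
  then have "\<alpha> * (1 - \<beta>) / M * (g\<^sup>2 / (norm s)\<^sup>2) \<le> \<alpha> * g" using M by (simp add: mult_ac)
  then show "f (x + s) \<le> f x - \<alpha> * (1 - \<beta>) / M * ((gradient f x \<bullet> s)\<^sup>2 / (norm s)\<^sup>2)"
    using armijo by (simp add: g_def)
qed

section \<open>Convergence of Block BFGS\<close>

lemma quasi_newton_direction:
  fixes B :: "real^'n^'n"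
  assumes B: "pos_def B" and g: "g \<noteq> 0"
  defines "d \<equiv> - (matrix_inv B *v g)"
  shows "B *v d = - g" and "g \<bullet> d < 0"
proof -
  have "\<exists>B'. B ** B' = Finite_Cartesian_Product.mat 1 \<and> B' ** B = Finite_Cartesian_Product.mat 1"
    using pos_def_invertible [OF B] by (simp add: invertible_def)
  then have "B ** matrix_inv B = Finite_Cartesian_Product.mat 1"
    unfolding matrix_inv_def by (rule someI2_ex) simp
  then show Bd: "B *v d = - g"
    by (simp add: d_def linear_neg [OF matrix_vector_mul_linear] matrix_vector_mul_assoc)
  then have "d \<noteq> 0" using g by auto
  then have "0 < d \<bullet> (B *v d)" using B by (simp add: pos_def_def)
  then show "g \<bullet> d < 0" by (simp add: Bd inner_commute)
qed

lemma block_bfgs_runD: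
  assumes "block_bfgs_run f x1 B1 q \<tau> \<alpha> \<beta> x d l s B" and "k \<ge> 1"
  shows "i \<in> {1..q} \<Longrightarrow> d k i = - (matrix_inv (B k) *v gradient f (x k i))"
    and "i \<in> {1..q} \<Longrightarrow> l k i > 0"
    and "i \<in> {1..q} \<Longrightarrow> armijo_wolfe f \<alpha> \<beta> (x k i) (d k i) (l k i)"
    and "i \<in> {1..q} \<Longrightarrow> s k i = l k i *\<^sub>R d k i"
    and "i \<in> {1..q} \<Longrightarrow> x k (i + 1) = x k i + s k i"
    and "B (k + 1) = block_update (B k) (hessian f (x k (q + 1)))
      (filter_steps \<tau> (map (s k) [1..<q + 1]) (hessian f (x k (q + 1))))"
    and "x (k + 1) 1 = x k (q + 1)"
  using assms unfolding block_bfgs_run_def Let_def by blast+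

lemma block_bfgs_steps:
  fixes f :: "real^'n \<Rightarrow> real"
  assumes run: "block_bfgs_run f x1 B1 q \<tau> \<alpha> \<beta> x d l s B"
    and g: "\<forall>k\<ge>1. \<forall>i\<in>{1..q}. gradient f (x k i) \<noteq> 0"
    and k: "k \<ge> 1" "pos_def (B k)" and i: "i \<in> {1..q}"
  shows "B k *v s k i = - (l k i *\<^sub>R gradient f (x k i))" and "gradient f (x k i) \<bullet> d k i < 0"
    and "s k i \<noteq> 0"
proof -
  note r = block_bfgs_runD [OF run k(1)]
  have gi: "gradient f (x k i) \<noteq> 0" using g k i by blast
  note dir = quasi_newton_direction [OF k(2) gi, folded r(1) [OF i]]
  show "B k *v s k i = - (l k i *\<^sub>R gradient f (x k i))"
    by (simp add: r(4) [OF i] matrix_vector_mult_scaleR dir(1))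
  show "gradient f (x k i) \<bullet> d k i < 0" by (rule dir(2))
  then show "s k i \<noteq> 0" using r(2) [OF i] by (auto simp: r(4) [OF i])
qed

text \<open>The two assertions depend on each other: positive definiteness of \<open>B\<^sub>k\<close> makes the directions of the
  block descent directions, so the block stays in the level set, and there the Hessian used in the
  next update is positive semidefinite.\<close>
lemma block_bfgs_invariant:
  fixes f :: "real^'n \<Rightarrow> real"
  assumes f: "convex_on UNIV f" "twice_differentiable f"
    and M: "M > 0" "\<forall>y\<in>{y. f y \<le> f x1}. loewner_le (hessian f y) (M *\<^sub>R Finite_Cartesian_Product.mat 1)"
    and B1: "pos_def B1" and \<tau>: "\<tau> > 0" and par: "0 < \<alpha>" "\<beta> < 1"
    and run: "block_bfgs_run f x1 B1 q \<tau> \<alpha> \<beta> x d l s B"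
    and g: "\<forall>k\<ge>1. \<forall>i\<in>{1..q}. gradient f (x k i) \<noteq> 0"
    and k: "k \<ge> 1"
  shows "pos_def (B k) \<and> (\<forall>i\<in>{1..q + 1}. f (x k i) \<le> f x1)"
proof -
  have level: "f (x k i) \<le> f x1"
    if k: "k \<ge> 1" "pos_def (B k)" "f (x k 1) \<le> f x1" and i: "1 \<le> i" "i \<le> q + 1" for k i
    using i
  proof (induction i rule: dec_induct)
    case base
    show ?case by (rule k(3))
  next
    case (step i)
    then have i: "i \<in> {1..q}" by auto
    note r = block_bfgs_runD [OF run k(1)]
    have "f (x k i + l k i *\<^sub>R d k i) \<le> f (x k i)"
      using armijo_wolfe_decrease(2) [OF f M par] step.IH i r(2,3) block_bfgs_steps(2) [OF run g k(1,2)]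
      by (metis Suc_leD step.prems)
    then show ?case using step r(4,5) [OF i] by simp
  qed
  have "pos_def (B k) \<and> f (x k 1) \<le> f x1"
    using k
  proof (induction k rule: dec_induct)
    case base
    show ?case using run B1 by (simp add: block_bfgs_run_def)
  next
    case (step k)
    then have k: "k \<ge> 1" "pos_def (B k)" "f (x k 1) \<le> f x1" by auto
    note r = block_bfgs_runD [OF run k(1)]
    let ?G = "hessian f (x k (q + 1))"
    have last: "f (x k (q + 1)) \<le> f x1" using level [OF k, of "q + 1"] by simp
    then have G: "pos_semidef ?G"
      using M by (intro hessian_pos_semidef [OF f]) auto
    have "0 \<notin> set (map (s k) [1..<q + 1])"
      using block_bfgs_steps(3) [OF run g k(1,2)] by (force simp: image_iff)
    then have "pos_def (B (k + 1))"
      unfolding r(6) using block_update_pos_def_det [OF k(2) G \<tau>] filtered_filter_steps by blast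
    then show ?case using last r(7) by simp
  qed
  then show ?thesis using level k by auto
qed

theorem theorem4p1:
  fixes f :: "real^'n \<Rightarrow> real" and x1 :: "real^'n" and B1 :: "real^'n^'n"
    and q :: nat and \<tau> \<alpha> \<beta> M :: real
    and x d s :: "nat \<Rightarrow> nat \<Rightarrow> real^'n" and l :: "nat \<Rightarrow> nat \<Rightarrow> real"
    and B :: "nat \<Rightarrow> real^'n^'n"
  assumes "convex_on UNIV f"
    and "twice_differentiable f"
    and "bdd_below (range f)"
    and "M > 0"
    and "\<forall>y\<in>{y. f y \<le> f x1}. loewner_le (hessian f y) (M *\<^sub>R Finite_Cartesian_Product.mat 1)"
    and "pos_def B1"
    and "q \<ge> 1"
    and "\<tau> > 0"
    and "0 < \<alpha>" and "\<alpha> < 1/2" and "\<alpha> < \<beta>" and "\<beta> < 1"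
    and "block_bfgs_run f x1 B1 q \<tau> \<alpha> \<beta> x d l s B"
    and "\<forall>k\<ge>1. \<forall>i\<in>{1..q}. gradient f (x k i) \<noteq> 0"
  shows "liminf (\<lambda>m. ereal (norm (gradient f (all_iterates q x m)))) = 0"
proof (rule ccontr)
  assume contr: "liminf (\<lambda>m. ereal (norm (gradient f (all_iterates q x m)))) \<noteq> 0"
  note f = assms(1,2) and M = assms(4,5) and q = \<open>q \<ge> 1\<close> and \<tau> = \<open>\<tau> > 0\<close>
    and par = \<open>0 < \<alpha>\<close> \<open>\<beta> < 1\<close> and run = assms(13) and g = assms(14)
  note inv = block_bfgs_invariant [OF f M assms(6) \<tau> par run g]
  note steps = block_bfgs_steps [OF run g]

  define blk where "blk m = m div q + 1" for m
  define pos where "pos m = m mod q + 1" for m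
  have blk: "blk m \<ge> 1" and pos: "pos m \<in> {1..q}" for m
    using q by (auto simp: blk_def pos_def Suc_le_eq)
  define X where "X m = all_iterates q x m" for m
  define s' where "s' m = s (blk m) (pos m)" for m
  have X: "X m = x (blk m) (pos m)" for m by (simp add: X_def all_iterates_def blk_def pos_def)
  have X_Suc: "X (Suc m) = X m + s' m" for m
  proof -
    have "X (Suc m) = x (blk m) (pos m + 1)"
    proof (cases "Suc (m mod q) = q")
      case True
      then show ?thesis
        using block_bfgs_runD(7) [OF run blk, of m]
        by (simp add: X_def all_iterates_def blk_def pos_def div_Suc mod_Suc)
    next
      case False
      then show ?thesis
        by (simp add: X_def all_iterates_def blk_def pos_def div_Suc mod_Suc)
    qed
    then show ?thesis
      using block_bfgs_runD(5) [OF run blk pos] by (simp add: X s'_def)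
  qed

  \<comment> \<open>The squared cosine of the angle between gradient and step, times the squared norm of the gradient.\<close>
  define \<theta> where "\<theta> m = (gradient f (X m) \<bullet> s' m)\<^sup>2 / (norm (s' m))\<^sup>2" for m
  define \<delta> where "\<delta> = \<alpha> * (1 - \<beta>) / M"
  have \<delta>: "\<delta> > 0" using par M by (simp add: \<delta>_def)
  have decrease: "f (X (Suc m)) \<le> f (X m) - \<delta> * \<theta> m" for m
  proof -
    note r = block_bfgs_runD [OF run blk [of m]]
    have Bm: "pos_def (B (blk m))" using inv [OF blk] by blast
    have "f (X m) \<le> f x1" using inv [OF blk, of m] pos [of m] by (simp add: X)
    then show ?thesis
      unfolding X_Suc \<theta>_def \<delta>_def
      using armijo_wolfe_decrease(1) [OF f M par _ r(2) [OF pos] steps(2) [OF blk Bm pos] r(3) [OF pos]]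
      by (simp add: X s'_def r(4) [OF pos])
  qed
  have \<theta>0: "\<theta> m \<ge> 0" for m by (simp add: \<theta>_def)
  have "\<theta> \<longlonglongrightarrow> 0"
  proof -
    have dec: "decseq (\<lambda>m. f (X m))"
    proof (rule decseq_SucI)
      show "f (X (Suc m)) \<le> f (X m)" for m
        using decrease [of m] mult_nonneg_nonneg [of \<delta> "\<theta> m"] \<delta> \<theta>0 [of m] by linarith
    qed
    obtain c where "\<forall>m. c \<le> f (X m)" using assms(3) by (auto simp: bdd_below_def)
    then obtain L where L: "(\<lambda>m. f (X m)) \<longlonglongrightarrow> L"
      using decseq_convergent [OF dec] by blast
    have lim: "(\<lambda>m. (f (X m) - f (X (Suc m))) / \<delta>) \<longlonglongrightarrow> (L - L) / \<delta>"
      using \<delta> by (intro tendsto_divide tendsto_diff L LIMSEQ_Suc [OF L] tendsto_const) auto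
    have le: "\<theta> m \<le> (f (X m) - f (X (Suc m))) / \<delta>" for m
      using decrease [of m] \<delta> by (simp add: pos_le_divide_eq mult.commute)
    show ?thesis
    proof (rule tendsto_sandwich)
      show "\<forall>\<^sub>F m in sequentially. 0 \<le> \<theta> m" using \<theta>0 by simp
      show "\<forall>\<^sub>F m in sequentially. \<theta> m \<le> (f (X m) - f (X (Suc m))) / \<delta>" using le by simp
      show "(\<lambda>m. (f (X m) - f (X (Suc m))) / \<delta>) \<longlonglongrightarrow> 0" using lim by simp
    qed simp
  qed

  obtain \<epsilon> where \<epsilon>: "\<epsilon> > 0" "\<forall>\<^sub>F m in sequentially. \<epsilon> < norm (gradient f (X m))"
  proof -
    have "0 \<le> liminf (\<lambda>m. ereal (norm (gradient f (all_iterates q x m))))"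
      by (rule Liminf_bounded) simp
    with contr have "0 < liminf (\<lambda>m. ereal (norm (gradient f (all_iterates q x m))))"
      by (simp add: order_less_le)
    then obtain e where e: "0 < ereal e" "ereal e < liminf (\<lambda>m. ereal (norm (gradient f (all_iterates q x m))))"
      using ereal_dense2 by blast
    show ?thesis
      by (rule that [of e]) (use e less_LiminfD [OF e(2)] in \<open>auto simp: X_def\<close>)
  qed

  obtain K where K: "\<And>k0. \<exists>k\<ge>k0. k \<ge> 1 \<and> (\<exists>v\<in>set (map (s k) [1..<q + 1]).
    (norm (B k *v v))\<^sup>2 * (norm v)\<^sup>2 < K * (v \<bullet> (B k *v v))\<^sup>2)"
  proof (rule block_updates_angle_condition [OF \<tau>, of B "\<lambda>k. hessian f (x k (q + 1))" "M * CARD('n)"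
        "\<lambda>k. map (s k) [1..<q + 1]" q])
    fix k :: nat
    assume k: "k \<ge> 1"
    show "pos_def (B k)" using inv [OF k] by simp
    have "f (x k (q + 1)) \<le> f x1" using inv [OF k] by simp
    then have "loewner_le (hessian f (x k (q + 1))) (M *\<^sub>R Finite_Cartesian_Product.mat 1)"
      using M by simp
    then show "pos_semidef (hessian f (x k (q + 1))) \<and> trace (hessian f (x k (q + 1))) \<le> M * CARD('n)"
      using hessian_pos_semidef [OF f] loewner_le_trace by blast
    show "0 \<notin> set (map (s k) [1..<q + 1]) \<and> map (s k) [1..<q + 1] \<noteq> [] \<and> length (map (s k) [1..<q + 1]) \<le> q"
      using steps(3) [OF k] inv [OF k] q by (force simp: image_iff)
    show "B (k + 1) = block_update (B k) (hessian f (x k (q + 1)))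
      (filter_steps \<tau> (map (s k) [1..<q + 1]) (hessian f (x k (q + 1))))"
      by (rule block_bfgs_runD(6) [OF run k])
  qed blast

  \<comment> \<open>This \<open>K\<close> is fixed, but \<open>K \<theta>\<close> tends to zero, so at a late enough step the inequality fails.\<close>
  have "(\<lambda>m. K * \<theta> m) \<longlonglongrightarrow> K * 0" by (intro tendsto_mult tendsto_const \<open>\<theta> \<longlonglongrightarrow> 0\<close>)
  then have "\<forall>\<^sub>F m in sequentially. K * \<theta> m < \<epsilon>\<^sup>2"
    using \<epsilon>(1) by (intro order_tendstoD) auto
  then have "\<forall>\<^sub>F m in sequentially. K * \<theta> m < \<epsilon>\<^sup>2 \<and> \<epsilon> < norm (gradient f (X m))"
    using \<epsilon>(2) by eventually_elim auto
  then obtain m0 where m0: "\<And>m. m \<ge> m0 \<Longrightarrow> K * \<theta> m < \<epsilon>\<^sup>2 \<and> \<epsilon> < norm (gradient f (X m))"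
    by (auto simp: eventually_sequentially)
  obtain k i where k: "k \<ge> m0 + 1" and i: "i \<in> {1..q}"
    and ki: "(norm (B k *v s k i))\<^sup>2 * (norm (s k i))\<^sup>2 < K * (s k i \<bullet> (B k *v s k i))\<^sup>2"
  proof -
    obtain k v where kv: "k \<ge> m0 + 1" "v \<in> set (map (s k) [1..<q + 1])"
      "(norm (B k *v v))\<^sup>2 * (norm v)\<^sup>2 < K * (v \<bullet> (B k *v v))\<^sup>2"
      using K by blast
    from kv(2) obtain i where "i \<in> {1..q}" "v = s k i" by force
    then show ?thesis using that kv by blast
  qed
  \<comment> \<open>The position of \<open>x k i\<close> in the enumeration, which starts at 0 while \<open>k\<close> and \<open>i\<close> start at 1.\<close>
  define m where "m = (k - 1) * q + (i - 1)"
  have mk: "blk m = k" "pos m = i"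
  proof -
    have "i - 1 < q" using i by auto
    then have "m div q = k - 1" "m mod q = i - 1" unfolding m_def by simp_all
    then show "blk m = k" "pos m = i" using k i by (auto simp: blk_def pos_def)
  qed
  have "k - 1 \<le> (k - 1) * q" using q by (cases q) auto
  then have "m \<ge> m0" using k unfolding m_def by linarith
  note m = m0 [OF this]
  have k1: "k \<ge> 1" "pos_def (B k)" using k inv by auto
  let ?g = "gradient f (x k i)" and ?s = "s k i"
  have l: "l k i > 0" by (rule block_bfgs_runD(2) [OF run k1(1) i])
  have sn: "norm ?s > 0" using steps(3) [OF k1 i] by simp
  have "(norm (B k *v ?s))\<^sup>2 = (l k i)\<^sup>2 * (norm ?g)\<^sup>2" "(?s \<bullet> (B k *v ?s))\<^sup>2 = (l k i)\<^sup>2 * (?g \<bullet> ?s)\<^sup>2"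
    by (simp_all add: steps(1) [OF k1 i] power_mult_distrib inner_commute)
  with ki l have "(norm ?g)\<^sup>2 * (norm ?s)\<^sup>2 < K * (?g \<bullet> ?s)\<^sup>2" by (simp add: mult_ac)
  then have "(norm ?g)\<^sup>2 < K * \<theta> m"
    using sn by (simp add: \<theta>_def X s'_def mk pos_less_divide_eq)
  moreover have "\<epsilon>\<^sup>2 \<le> (norm ?g)\<^sup>2"
    using m \<epsilon>(1) by (intro power_mono) (auto simp: X mk)
  ultimately show False using m by linarith
qed

end
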